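(* Let $k=m\cdot 2^n$, where $m\geq 1$ is odd and $n\ge 0$. A cubefree clipped Thue--Morse morphism of length $k$ (that is, a cubefree $f_{\ell,k}$ for some integer $\ell\ge 0$) exists if and only if $m\ne 3$. Moreover, for $m\neq 3$: (a) if $m\equiv 1 \pmod 8$, then $f_{4\cdot 2^n,\,k}$ is cubefree; (b) if $m\equiv 3\pmod 8$, then either $f_{k-5\cdot 2^n,\,k}$ or $f_{k-4\cdot 2^n,\,k}$ is cubefree; (c) if $m\equiv 5\pmod 8$, then $f_{0,k}$ is cubefree; (d) if $m\equiv 7\pmod 8$, then $f_{6\cdot 2^n,\,k}$ is cubefree.
   Context: Words are finite or (one-sided) infinite, over $\{0,1\}$, indexed from $0$; $w[i..j]=w[i]w[i+1]\cdots w[j]$. A factor is a contiguous sub-block. The complement $\overline{w}$ of a binary word $w$ is obtained by exchanging $0$ and $1$ letterwise. For a finite nonempty word $w$ of length $n$, an integer $p$ with $1\le p\le n$ is a period of $w$ if $w[i]=w[i+p]$ for $0\le i<n-p$; $\mathrm{per}(w)$ is the smallest period, and $\exp(w)=n/\mathrm{per}(w)$. The critical exponent $\mathrm{cexp}(w)$ of a finite or infinite word is the supremum of $\exp(x)$ over all finite nonempty factors $x$ of $w$. A word $w$ is cubefree if $\mathrm{cexp}(w)<3$. A morphism $h$ is cubefree if for all words $w$: $w$ cubefree implies $h(w)$ cubefree. The Thue--Morse word $\mathbf{t}=0110100110010110\cdots$ is the infinite fixed point starting with $0$ of the morphism $\mu:0\mapsto 01,\ 1\mapsto 10$. For integers $\ell\ge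 0$, $k\ge 1$, the clipped Thue--Morse morphism $f_{\ell,k}$ (of length $k$) is the morphism on $\{0,1\}$ with $f_{\ell,k}(0)=\mathbf{t}[\ell..\ell+k-1]$ and $f_{\ell,k}(1)=\overline{\mathbf{t}[\ell..\ell+k-1]}$. *)

theory Defs
  imports
    "HOL-Library.Stream"
    "HOL-Library.Sublist"
    "HOL-Library.Extended_Real"
begin

datatype 'a word = Fin "'a list" | Inf "'a stream"

fun factors :: "'a word \<Rightarrow> 'a list set" where
  "factors (Fin w) = {x. sublist x w}"
| "factors (Inf w) = {stake n (sdrop i w) | i n. True}"

definition is_period :: "'a list \<Rightarrow> nat \<Rightarrow> bool" where
  "is_period w p \<longleftrightarrow>
     1 \<le> p \<and> p \<le> length w \<and> (\<forall>i < length w - p. w ! i = w ! (i + p))"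

text \<open>Only meaningful for nonempty words; every nonempty word has its length as a period.\<close>

definition per :: "'a list \<Rightarrow> nat" where
  "per w = (LEAST p. is_period w p)"

definition expo :: "'a list \<Rightarrow> real" where
  "expo w = real (length w) / real (per w)"

text \<open>The supremum is taken in the extended reals: it may be infinite for an infinite word,
  and it is \<open>-\<infinity>\<close> for the empty word, which is therefore cubefree. For an infinite word,
  cubefree in the sense below is stronger than having no factor of exponent at least 3.\<close>

definition cexp :: "'a word \<Rightarrow> ereal" where
  "cexp w = (SUP x \<in> factors w - {[]}. ereal (expo x))"

definition cubefree :: "'a word \<Rightarrow> bool" where
  "cubefree w \<longleftrightarrow> cexp w < 3"

text \<open>A morphism is given by its images of letters. The action on infinite words
  is the intended one only if no letter is mapped to the empty word.\<close>

fun morph :: "('a \<Rightarrow> 'b list) \<Rightarrow> 'a word \<Rightarrow> 'b word" where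
  "morph h (Fin w) = Fin (concat (map h w))"
| "morph h (Inf w) = Inf (flat (smap h w))"

definition cubefree_morphism :: "('a \<Rightarrow> 'b list) \<Rightarrow> bool" where
  "cubefree_morphism h \<longleftrightarrow> (\<forall>w. cubefree w \<longrightarrow> cubefree (morph h w))"

text \<open>The letters 0 and 1 are \<^term>\<open>False\<close> and \<^term>\<open>True\<close>.\<close>

definition complement :: "bool list \<Rightarrow> bool list" where
  "complement w = map Not w"

definition \<mu> :: "bool \<Rightarrow> bool list" where
  "\<mu> a = (if a then [True, False] else [False, True])"

definition thue_morse :: "bool stream" where
  "thue_morse = (THE s. shd s = False \<and> morph \<mu> (Inf s) = Inf s)"

definition clipped_TM :: "nat \<Rightarrow> nat \<Rightarrow> bool \<Rightarrow> bool list" where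
  "clipped_TM l k a =
     (let b = stake k (sdrop l thue_morse) in if a then complement b else b)"

lemma stream_eq_nth: "s = s' \<longleftrightarrow> (\<forall>n. s !! n = s' !! n)"
  using smap_alt[of id s s'] by (simp add: stream.map_id)

lemma flat_mu_snth: "flat (smap \<mu> s) !! n = (s !! (n div 2) \<noteq> odd n)"
proof (induction n arbitrary: s rule: less_induct)
  case (less n)
  have ne: "\<forall>xs \<in> sset (smap \<mu> s). xs \<noteq> []"
    by (auto simp: \<mu>_def stream.set_map)
  have len: "length (\<mu> a) = 2" for a
    by (simp add: \<mu>_def)
  show ?case
  proof (cases "n < 2")
    case True
    then have "n = 0 \<or> n = 1" by auto
    then show ?thesis
      using flat_snth[OF ne, of n] by (cases "shd s") (auto simp: \<mu>_def)
  next
    case False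
    then obtain j where j: "n = Suc (Suc j)"
      by (metis less_2_cases_iff not0_implies_Suc One_nat_def)
    have "flat (smap \<mu> s) !! n = flat (smap \<mu> (stl s)) !! j"
      using flat_snth[OF ne, of n] by (simp add: len j)
    also have "\<dots> = (stl s !! (j div 2) \<noteq> odd j)"
      using less.IH[of j "stl s"] j by simp
    finally show ?thesis by (simp add: j)
  qed
qed

text \<open>The definite description defining \<^const>\<open>thue_morse\<close> is legitimate.\<close>

lemma thue_morse_ex1: "\<exists>!s. shd s = False \<and> morph \<mu> (Inf s) = Inf s"
proof -
  define P where "P s \<longleftrightarrow> shd s = False \<and> (\<forall>n. s !! n = (s !! (n div 2) \<noteq> odd n))"
    for s :: "bool stream"
  have P: "(shd s = False \<and> morph \<mu> (Inf s) = Inf s) \<longleftrightarrow> P s" for s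
    unfolding P_def morph.simps word.inject
    by (subst stream_eq_nth, subst flat_mu_snth) (rule arg_cong2[of _ _ _ _ "(\<and>)"], rule refl, blast)
  obtain g :: "nat \<Rightarrow> bool"
    where g: "\<And>n. g n = (if n = 0 then False else g (n div 2) \<noteq> odd n)"
  proof -
    define g where "g = wfrec less_than
      (\<lambda>f n. if n = 0 then False else f (n div 2) \<noteq> odd (n::nat))"
    have "g n = (if n = 0 then False else g (n div 2) \<noteq> odd n)" for n
      by (subst def_wfrec[OF g_def[THEN eq_reflection] wf_less_than]) (simp add: cut_def)
    then show ?thesis by (rule that)
  qed
  have "P (smap g nats)"
    unfolding P_def
  proof (intro conjI allI)
    show "shd (smap g nats) = False" using g[of 0] by simp
    show "smap g nats !! n = (smap g nats !! (n div 2) \<noteq> odd n)" for n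
      using g[of n] g[of 0] by (cases "n = 0") simp_all
  qed
  moreover have "s = s'" if "P s" "P s'" for s s'
  proof -
    have "s !! n = s' !! n" for n
    proof (induction n rule: less_induct)
      case (less n)
      show ?case
      proof (cases "n = 0")
        case True
        moreover have "\<not> shd s" "\<not> shd s'" using that unfolding P_def by blast+
        ultimately show ?thesis by simp
      next
        case False
        then have "s !! (n div 2) = s' !! (n div 2)" using less by simp
        moreover have "s !! n = (s !! (n div 2) \<noteq> odd n)" "s' !! n = (s' !! (n div 2) \<noteq> odd n)"
          using that unfolding P_def by blast+
        ultimately show ?thesis by argo
      qed
    qed
    then show ?thesis by (simp add: stream_eq_nth)
  qed
  ultimately show ?thesis unfolding P by blast
qed

end

theory Submission
  imports Defs
begin

text \<open>
  Write \<open>t\<close> for the Thue--Morse word and \<open>u\<close> for the block \<open>t[l..l+k-1]\<close>, so that the image of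
  a word \<open>w\<close> is a sequence of blocks, each equal to \<open>u\<close> or to its complement. Comparing one position
  of a block with the same position of another block decides whether their letters in \<open>w\<close> agree;
  hence a repetition of the image whose period is a multiple of \<open>k\<close> comes from a repetition of \<open>w\<close> of at
  least the same exponent. Cubefreeness is therefore a question about periods that \<open>k\<close> does not
  divide (\<open>cubefree_morphism_complementI\<close>). As the critical exponent of an infinite word is a
  supremum, the exponents of such repetitions have to be bounded by one constant below \<open>3\<close>.

  Since \<open>\<mu>\<close> is cubefree and \<open>f\<^bsub>2l,2k\<^esub> = \<mu> \<circ> f\<^bsub>l,k\<^esub>\<close>, the positive statements only need to be
  proved for \<open>n = 0\<close>, that is for odd \<open>k\<close>. There the decisive fact is that two factors of \<open>t\<close> that
  start at positions of different parity are equal or complementary only up to length \<open>3\<close>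
  (\<open>tm_odd_shift\<close>). When a block is laid over two consecutive blocks, shifted by \<open>r\<close> with \<open>0 < r < k\<close>,
  it is compared with them at the distances \<open>r\<close> and \<open>k - r\<close>. One of these is odd, as \<open>k\<close> is, so that
  overlap has length at most \<open>3\<close>; the other distance is then \<open>2\<close>, for which a constant difference is
  also short. Hence no block of the image occurs out of phase once \<open>k \<ge> 9\<close>, and this excludes cubes of
  period larger than \<open>k\<close>. The same parity argument, together with the
  overlap-freeness of \<open>t\<close>, shows that a cube of period \<open>p < k\<close> can only sit across a boundary between two
  blocks, and only for \<open>p \<in> {1, 2, 3, 5}\<close> (\<open>short_cube_boundary\<close>). Whether it exists is decided by
  the first eight and the last eight letters of \<open>u\<close>. For the offsets \<open>4\<close>, \<open>0\<close> and \<open>6\<close> in the residue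
  classes \<open>1\<close>, \<open>5\<close> and \<open>7\<close> modulo \<open>8\<close> the block always ends just before a position congruent to \<open>5\<close> modulo
  \<open>8\<close>, which determines its last four letters up to complement; these and the first seven letters
  exclude all boundary cubes. For \<open>k = 8q + 11\<close> both ends depend on \<open>t[q]\<close> and
  \<open>t[q+1]\<close>, and the offset \<open>k - 5\<close> works if these letters differ, \<open>k - 4\<close> if they are equal.
  The lengths \<open>1\<close>, \<open>5\<close> and \<open>7\<close> are handled separately.

  For \<open>m = 3\<close> the image of some word of length two contains a cube (\<open>pair_image_cube_three_power\<close>).
  If \<open>l\<close> and \<open>k\<close> are even, one may halve them. Otherwise a square of a letter at an end of \<open>u\<close> extends to
  a cube across the boundary, and if there is none at either end, \<open>k\<close> is \<open>3\<close> or \<open>6\<close> and the letters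
  around the boundary alternate, giving a cube of period two.
\<close>

section \<open>Repetitions and cubefreeness\<close>

fun letter :: "'a word \<Rightarrow> nat \<Rightarrow> 'a" where
  "letter (Fin w) i = w ! i"
| "letter (Inf s) i = s !! i"

fun wlength :: "'a word \<Rightarrow> enat" where
  "wlength (Fin w) = enat (length w)"
| "wlength (Inf s) = \<infinity>"

text \<open>The factor of length \<open>L\<close> that starts at \<open>s\<close> has period \<open>p\<close>. Working with positions and arbitrary
  (not only smallest) periods treats finite and infinite words alike.\<close>
definition repetition :: "(nat \<Rightarrow> 'a) \<Rightarrow> nat \<Rightarrow> nat \<Rightarrow> nat \<Rightarrow> bool" where
  "repetition f s L p \<longleftrightarrow> (\<forall>x. s \<le> x \<longrightarrow> x + p < s + L \<longrightarrow> f x = f (x + p))"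

lemma word_eqI:
  assumes "wlength v = wlength w" "\<And>i. enat i < wlength w \<Longrightarrow> letter v i = letter w i"
  shows "v = w"
  using assms by (cases v; cases w) (auto intro: nth_equalityI simp: stream_eq_nth)

lemma factors_iff:
  "x \<in> factors w \<longleftrightarrow>
    (\<exists>s. enat (s + length x) \<le> wlength w \<and> (\<forall>j < length x. x ! j = letter w (s + j)))"
proof (cases w)
  case (Fin v)
  have "sublist x v \<longleftrightarrow> (\<exists>s. s + length x \<le> length v \<and> (\<forall>j < length x. x ! j = v ! (s + j)))"
  proof
    assume "sublist x v"
    then obtain a b where "v = a @ x @ b" by (auto simp: sublist_def)
    then show "\<exists>s. s + length x \<le> length v \<and> (\<forall>j < length x. x ! j = v ! (s + j))"
      by (intro exI[of _ "length a"]) (simp add: nth_append)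
  next
    assume "\<exists>s. s + length x \<le> length v \<and> (\<forall>j < length x. x ! j = v ! (s + j))"
    then obtain s where s: "s + length x \<le> length v" "\<forall>j < length x. x ! j = v ! (s + j)" by blast
    then have "x = take (length x) (drop s v)" by (intro nth_equalityI) auto
    then have "v = take s v @ x @ drop (length x) (drop s v)" by (metis append_take_drop_id)
    then show "sublist x v" unfolding sublist_def by blast
  qed
  then show ?thesis by (simp add: Fin)
next
  case (Inf v)
  have "x \<in> factors w \<longleftrightarrow> (\<exists>s. x = stake (length x) (sdrop s v))"
    unfolding Inf by (auto simp del: length_stake intro: exI) (metis length_stake)
  also have "\<dots> \<longleftrightarrow> (\<exists>s. \<forall>j < length x. x ! j = v !! (s + j))"
    by (simp add: list_eq_iff_nth_eq sdrop_snth)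
  finally show ?thesis by (simp add: Inf)
qed

lemma is_period_per:
  assumes "x \<noteq> []" shows "is_period x (per x)"
  unfolding per_def
proof (rule LeastI)
  show "is_period x (length x)" using assms by (cases x) (auto simp: is_period_def)
qed

text \<open>The smallest period gives the largest exponent, so an upper bound for the exponent may be tested
  on all periods.\<close>
lemma expo_le_iff:
  assumes "x \<noteq> []" "0 \<le> c"
  shows "expo x \<le> c \<longleftrightarrow> (\<forall>p. is_period x p \<longrightarrow> real (length x) \<le> c * real p)"
proof -
  have per: "is_period x (per x)" by (rule is_period_per[OF assms(1)])
  then have "0 < per x" by (simp add: is_period_def)
  then have eq: "expo x \<le> c \<longleftrightarrow> real (length x) \<le> c * real (per x)"
    by (simp add: expo_def divide_le_eq)
  have "c * real (per x) \<le> c * real p" if "is_period x p" for p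
    using that assms(2) unfolding per_def by (intro mult_left_mono) (simp_all add: Least_le)
  with per eq show ?thesis by (meson order_trans)
qed

text \<open>The constant \<open>c\<close> is uniform: for an infinite word without cubes the exponents could still
  approach \<open>3\<close>, and then the word would not be cubefree.\<close>
lemma cubefree_iff:
  "cubefree w \<longleftrightarrow> (\<exists>c<3. \<forall>s L p. enat (s + L) \<le> wlength w \<longrightarrow> 0 < p \<longrightarrow> p \<le> L \<longrightarrow>
     repetition (letter w) s L p \<longrightarrow> real L \<le> c * real p)" (is "_ \<longleftrightarrow> (\<exists>c<3. ?B c)")
proof -
  have rep: "?B c \<longleftrightarrow> (\<forall>x \<in> factors w - {[]}. expo x \<le> c)" if "0 \<le> c" for c
  proof
    assume B: "?B c"
    show "\<forall>x \<in> factors w - {[]}. expo x \<le> c"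
    proof
      fix x assume x: "x \<in> factors w - {[]}"
      then obtain s where s: "enat (s + length x) \<le> wlength w"
          "\<And>j. j < length x \<Longrightarrow> x ! j = letter w (s + j)"
        unfolding Diff_iff factors_iff by blast
      have "real (length x) \<le> c * real p" if p: "is_period x p" for p
      proof -
        have "repetition (letter w) s (length x) p"
          unfolding repetition_def
        proof (intro allI impI)
          fix y assume y: "s \<le> y" "y + p < s + length x"
          then have "x ! (y - s) = x ! (y - s + p)" using p by (simp add: is_period_def)
          with y show "letter w y = letter w (y + p)"
            using s(2)[of "y - s"] s(2)[of "y - s + p"] by (simp add: algebra_simps)
        qed
        with B s(1) p show ?thesis by (simp add: is_period_def)
      qed
      with x that show "expo x \<le> c" by (simp add: expo_le_iff)
    qed
  next
    assume E: "\<forall>x \<in> factors w - {[]}. expo x \<le> c"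
    show "?B c"
    proof (intro allI impI)
      fix s L p assume h: "enat (s + L) \<le> wlength w" "0 < p" "p \<le> L" "repetition (letter w) s L p"
      define x where "x = map (\<lambda>j. letter w (s + j)) [0..<L]"
      have "x \<in> factors w" unfolding factors_iff using h(1) by (auto simp: x_def intro!: exI[of _ s])
      moreover have "x \<noteq> []" using h by (auto simp: x_def)
      moreover have "is_period x p"
        using h by (auto simp: is_period_def x_def repetition_def add.assoc)
      ultimately have "real (length x) \<le> c * real p" using E that expo_le_iff[of x c] by blast
      then show "real L \<le> c * real p" by (simp add: x_def)
    qed
  qed
  have "cubefree w \<longleftrightarrow> (\<exists>c::real. 0 \<le> c \<and> c < 3 \<and> (\<forall>x \<in> factors w - {[]}. expo x \<le> c))"
  proof
    assume "cubefree w"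
    then have "max 0 (cexp w) < 3" by (simp add: cubefree_def)
    then obtain c where c: "max 0 (cexp w) = ereal c"
      by (cases "max 0 (cexp w)") (auto simp: max_def split: if_splits)
    then have "expo x \<le> c" if "x \<in> factors w - {[]}" for x
      using SUP_upper[OF that, of "\<lambda>x. ereal (expo x)"] unfolding cexp_def
      by (metis ereal_less_eq(3) max.coboundedI2)
    moreover have "0 \<le> c" using c by (metis ereal_less_eq(5) max.cobounded1)
    moreover have "c < 3" using \<open>max 0 (cexp w) < 3\<close> unfolding c by simp
    ultimately show "\<exists>c::real. 0 \<le> c \<and> c < 3 \<and> (\<forall>x \<in> factors w - {[]}. expo x \<le> c)" by blast
  next
    assume "\<exists>c::real. 0 \<le> c \<and> c < 3 \<and> (\<forall>x \<in> factors w - {[]}. expo x \<le> c)"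
    then obtain c :: real where "c < 3" "\<forall>x \<in> factors w - {[]}. expo x \<le> c" by blast
    then have "cexp w \<le> ereal c" unfolding cexp_def by (intro SUP_least) simp
    also have "\<dots> < 3" using \<open>c < 3\<close> by simp
    finally show "cubefree w" by (simp add: cubefree_def)
  qed
  also have "\<dots> \<longleftrightarrow> (\<exists>c<3. ?B c)"
  proof
    assume "\<exists>c::real. 0 \<le> c \<and> c < 3 \<and> (\<forall>x \<in> factors w - {[]}. expo x \<le> c)"
    then show "\<exists>c<3. ?B c" using rep by blast
  next
    assume "\<exists>c<3. ?B c"
    then obtain c where c: "c < 3" "?B c" by blast
    \<comment> \<open>\<open>expo_le_iff\<close> needs a nonnegative bound\<close>
    have "?B (max 0 c)"
    proof (intro allI impI)
      fix s L p assume "enat (s + L) \<le> wlength w" "0 < p" "p \<le> L" "repetition (letter w) s L p"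
      then have "real L \<le> c * real p" using c(2) by blast
      also have "\<dots> \<le> max 0 c * real p" by (intro mult_right_mono) auto
      finally show "real L \<le> max 0 c * real p" .
    qed
    then show "\<exists>c::real. 0 \<le> c \<and> c < 3 \<and> (\<forall>x \<in> factors w - {[]}. expo x \<le> c)"
      using c(1) rep[of "max 0 c"] by (intro exI[of _ "max 0 c"]) auto
  qed
  finally show ?thesis .
qed

section \<open>Morphisms with two complementary images\<close>

lemma concat_map_nth_uniform:
  assumes "\<And>a. length (h a) = k" "i < k * length w"
  shows "concat (map h w) ! i = h (w ! (i div k)) ! (i mod k)"
  using assms(2)
proof (induction w arbitrary: i)
  case (Cons a w)
  then have k: "0 < k" by (cases k) auto
  show ?case
  proof (cases "i < k")
    case True
    then show ?thesis by (simp add: nth_append assms(1))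
  next
    case False
    then have "concat (map h w) ! (i - k) = h (w ! ((i - k) div k)) ! ((i - k) mod k)"
      using Cons by (intro Cons.IH) simp
    with False k show ?thesis
      by (simp add: nth_append assms(1) le_div_geq le_mod_geq)
  qed
qed simp

lemma flat_snth_uniform:
  assumes "\<And>a. length (h a) = k" "0 < k"
  shows "flat (smap h s) !! i = h (s !! (i div k)) ! (i mod k)"
proof (induction i arbitrary: s rule: less_induct)
  case (less i)
  have ne: "\<forall>xs \<in> sset (smap h s). xs \<noteq> []"
    using assms by (auto simp: stream.set_map simp flip: length_greater_0_conv)
  show ?case
  proof (cases "i < k")
    case True
    then show ?thesis using flat_snth[OF ne, of i] assms by simp
  next
    case False
    then have "flat (smap h s) !! i = flat (smap h (stl s)) !! (i - k)"
      using flat_snth[OF ne, of i] assms by simp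
    with False assms(2) show ?thesis
      using less.IH[of "i - k" "stl s"] by (simp add: le_div_geq le_mod_geq)
  qed
qed

lemma wlength_morph_uniform:
  assumes "\<And>a. length (h a) = k" "0 < k"
  shows "wlength (morph h w) = enat k * wlength w"
proof (cases w)
  case (Fin v)
  have "length (concat (map h v)) = k * length v" by (induction v) (simp_all add: assms(1))
  then show ?thesis by (simp add: Fin)
qed (use assms(2) in \<open>simp add: zero_enat_def\<close>)

lemma letter_morph_uniform:
  assumes "\<And>a. length (h a) = k" "0 < k" "enat i < wlength (morph h w)"
  shows "letter (morph h w) i = h (letter w (i div k)) ! (i mod k)"
proof (cases w)
  case (Fin v)
  then show ?thesis using assms(3) wlength_morph_uniform[of h k w] assms(1,2)
    by (simp add: concat_map_nth_uniform)
qed (simp add: flat_snth_uniform[OF assms(1,2)])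

text \<open>The image of \<open>v\<close> under the morphism that sends the letters to \<open>u[0..k-1]\<close> and its complement;
  inequality of truth values is their sum modulo two.\<close>
definition blocks :: "(nat \<Rightarrow> bool) \<Rightarrow> nat \<Rightarrow> (nat \<Rightarrow> bool) \<Rightarrow> nat \<Rightarrow> bool" where
  "blocks u k v x = (u (x mod k) \<noteq> v (x div k))"

lemma blocks_at:
  "j < k \<Longrightarrow> blocks u k v (i * k + j) = (u j \<noteq> v i)"
  by (simp add: blocks_def)

text \<open>Periods \<open>k * q\<close> are controlled by the preimage. If any position of
  block \<open>i\<close> is compared with its translate, the letters \<open>i\<close> and \<open>i + q\<close> of the preimage agree, because
  \<open>u\<close> and its complement differ everywhere. So all blocks that the repetition touches, even partially,
  form a repetition of period \<open>q\<close> in the preimage, whose exponent is not smaller.\<close>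
lemma cubefree_morphism_complementI:
  fixes u :: "nat \<Rightarrow> bool" and c :: real
  assumes h: "\<And>a. h a = map (\<lambda>j. u j \<noteq> a) [0..<k]" and "0 < k" "c < 3"
    and sync: "\<And>v s L p. 0 < p \<Longrightarrow> \<not> k dvd p \<Longrightarrow> p \<le> L \<Longrightarrow>
      repetition (blocks u k v) s L p \<Longrightarrow> real L \<le> c * real p"
  shows "cubefree_morphism h"
  unfolding cubefree_morphism_def
proof (intro allI impI)
  fix w :: "bool word"
  assume "cubefree w"
  then obtain d where d: "d < 3" and B: "\<And>s L p. enat (s + L) \<le> wlength w \<Longrightarrow> 0 < p \<Longrightarrow>
      p \<le> L \<Longrightarrow> repetition (letter w) s L p \<Longrightarrow> real L \<le> d * real p"
    unfolding cubefree_iff by blast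
  have len: "length (h a) = k" for a by (simp add: h)
  let ?g = "blocks u k (letter w)"
  \<comment> \<open>the bound \<open>1\<close> covers \<open>L = p\<close>, where no two positions are compared\<close>
  have lift: "real L \<le> max 1 d * real p"
    if in_w: "enat (s + L) \<le> wlength (morph h w)" and "0 < p" "k dvd p" "p \<le> L" "repetition ?g s L p"
    for s L p
  proof (cases "L = p")
    case False
    obtain q where q: "p = k * q" using \<open>k dvd p\<close> by blast
    define i0 i1 where "i0 = s div k" and "i1 = (s + L - 1) div k"
    have L: "p < L" using False \<open>p \<le> L\<close> by simp
    have i0: "i0 * k \<le> s" "s < i0 * k + k" and i1: "i1 * k \<le> s + L - 1" "s + L - 1 < i1 * k + k"
      unfolding i0_def i1_def using \<open>0 < k\<close>
      by (simp_all add: div_times_less_eq_dividend dividend_less_div_times add.commute)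
    have "(i0 + q) * k \<le> s + L - 1" using i0 L q by (simp add: algebra_simps)
    then have le: "i0 + q \<le> i1" unfolding i1_def using \<open>0 < k\<close> by (simp add: less_eq_div_iff_mult_less_eq)
    have "enat (i0 + (i1 - i0 + 1)) \<le> wlength w"
    proof (cases w)
      case (Fin v)
      then have "s + L \<le> k * length v" using in_w wlength_morph_uniform[OF len \<open>0 < k\<close>, where w = w] by simp
      then have "s + L - 1 < length v * k" using L by (simp add: mult.commute)
      then have "i1 < length v" unfolding i1_def by (simp add: less_mult_imp_div_less)
      with le Fin show ?thesis by simp
    qed simp
    moreover have "0 < q" using q \<open>0 < p\<close> by simp
    moreover have "q \<le> i1 - i0 + 1" using le by simp
    moreover have "repetition (letter w) i0 (i1 - i0 + 1) q"
      unfolding repetition_def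
    proof (intro allI impI)
      fix i assume i: "i0 \<le> i" "i + q < i0 + (i1 - i0 + 1)"
      then have "i + q \<le> i1" using le by simp
      then have *: "(i + q) * k \<le> s + L - 1" using i1(1) by (meson le_trans mult_le_mono1)
      \<comment> \<open>some position of block \<open>i\<close> is compared with the same position of block \<open>i + q\<close>\<close>
      define x where "x = max s (i * k)"
      have "i * k \<le> x" "x < i * k + k"
        using i0(2) i(1) \<open>0 < k\<close> by (auto simp: x_def max_def) (meson le_less_trans add_le_mono1 less_le_trans mult_le_mono1)
      then obtain j where j: "x = i * k + j" "j < k" by (metis le_iff_add nat_add_left_cancel_less)
      have "s \<le> x" "x + p < s + L"
        using * L by (auto simp: x_def max_def q algebra_simps)
      then have "?g x = ?g (x + p)"
        using \<open>repetition ?g s L p\<close> by (simp add: repetition_def)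
      also have "x + p = (i + q) * k + j" using j q by (simp add: algebra_simps)
      finally show "letter w i = letter w (i + q)"
        unfolding j(1) blocks_at[OF j(2)] by blast
    qed
    ultimately have "real (i1 - i0 + 1) \<le> d * real q" by (rule B)
    moreover have "L \<le> k * (i1 - i0 + 1)"
    proof -
      have "i0 * k + L \<le> i1 * k + k" using i0 i1(2) L by linarith
      then show ?thesis using le by (simp add: algebra_simps diff_mult_distrib)
    qed
    then have "real L \<le> real k * real (i1 - i0 + 1)" by (metis of_nat_le_iff of_nat_mult)
    ultimately have "real L \<le> real k * (d * real q)"
      by (meson mult_left_mono of_nat_0_le_iff order_trans)
    also have "\<dots> = d * real p" by (simp add: q)
    also have "\<dots> \<le> max 1 d * real p" by (intro mult_right_mono) auto
    finally show ?thesis .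
  qed (simp add: mult_le_cancel_right1)
  show "cubefree (morph h w)"
    unfolding cubefree_iff
  proof (intro exI[of _ "max (max 1 d) c"] conjI allI impI)
    show "max (max 1 d) c < 3" using d \<open>c < 3\<close> by simp
    fix s L p assume a: "enat (s + L) \<le> wlength (morph h w)" "0 < p" "p \<le> L"
      "repetition (letter (morph h w)) s L p"
    have "letter (morph h w) x = ?g x" if "x < s + L" for x
    proof -
      have "enat x < wlength (morph h w)" using that a(1) by (metis enat_ord_simps(2) less_le_trans)
      then show ?thesis
        using letter_morph_uniform[OF len \<open>0 < k\<close>, where i = x and w = w] \<open>0 < k\<close> by (simp add: blocks_def h[of "letter w _"])
    qed
    then have g: "repetition ?g s L p" using a(4) unfolding repetition_def by (metis add_lessD1)
    have "real L \<le> max 1 d * real p \<or> real L \<le> c * real p"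
      using lift[OF a(1,2) _ a(3) g] sync[OF a(2) _ a(3) g] by blast
    then show "real L \<le> max (max 1 d) c * real p"
      by (elim disjE) (erule order_trans, rule mult_right_mono, simp_all)+
  qed
qed

section \<open>Factors of the Thue--Morse word\<close>

definition tm :: "nat \<Rightarrow> bool" where
  "tm i = thue_morse !! i"

lemma tm_rec: "tm i = (tm (i div 2) \<noteq> odd i)" and tm_0: "\<not> tm 0"
proof -
  have *: "shd thue_morse = False \<and> morph \<mu> (Inf thue_morse) = Inf thue_morse"
    unfolding thue_morse_def by (rule theI'[OF thue_morse_ex1])
  then show "\<not> tm 0" by (simp add: tm_def)
  from * have "thue_morse !! i = flat (smap \<mu> thue_morse) !! i" by simp
  then show "tm i = (tm (i div 2) \<noteq> odd i)" unfolding tm_def flat_mu_snth .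
qed

lemma tm_even [simp]: "tm (2 * i) = tm i" and tm_odd [simp]: "tm (Suc (2 * i)) = (\<not> tm i)"
  using tm_rec[of "2 * i"] tm_rec[of "Suc (2 * i)"] by simp_all

lemma tm_step_even: "even i \<Longrightarrow> tm (Suc i) = (\<not> tm i)"
  by (elim evenE) simp

lemma tm_cube_free: "\<not> (tm i = tm (i + 1) \<and> tm (i + 1) = tm (i + 2))"
  using tm_step_even[of i] tm_step_even[of "i + 1"] by auto

text \<open>An alternating factor of length four at an odd position would make three consecutive letters of the
  preimage under \<open>\<mu>\<close> equal.\<close>
lemma tm_alternating_odd:
  assumes "odd i"
  shows "\<not> (tm i \<noteq> tm (i + 1) \<and> tm (i + 1) \<noteq> tm (i + 2) \<and> tm (i + 2) \<noteq> tm (i + 3))"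
proof -
  obtain j where i: "i = 2 * j + 1" using assms by (elim oddE)
  have "i + 1 = 2 * (j + 1)" "i + 2 = Suc (2 * (j + 1))" "i + 3 = 2 * (j + 2)" by (simp_all add: i)
  then have "tm i = (\<not> tm j)" "tm (i + 1) = tm (j + 1)" "tm (i + 2) = (\<not> tm (j + 1))" "tm (i + 3) = tm (j + 2)"
    by (simp_all only: tm_even tm_odd) (simp add: i)
  with tm_cube_free[of j] show ?thesis by auto
qed

text \<open>Each factor \<open>t[2i..2i+1]\<close> consists of two different letters. If two factors at positions of
  different parity are equal or complementary, each one inherits this from the other, so both
  alternate; one of them starts at an odd position.\<close>
lemma tm_odd_shift:
  assumes "odd (a + b)" "\<And>j. j < 4 \<Longrightarrow> (tm (a + j) \<noteq> tm (b + j)) = c"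
  shows False
proof -
  have *: False if "odd a" "even b" "\<And>j. j < 4 \<Longrightarrow> (tm (a + j) \<noteq> tm (b + j)) = c" for a b
  proof -
    \<comment> \<open>the blocks of \<open>\<mu>\<close> start at \<open>b\<close>, \<open>a + 1\<close> and \<open>b + 2\<close>, which makes \<open>t[a..a+3]\<close> alternate\<close>
    have c: "(tm a \<noteq> tm b) = c" "(tm (a + 1) \<noteq> tm (b + 1)) = c"
        "(tm (a + 2) \<noteq> tm (b + 2)) = c" "(tm (a + 3) \<noteq> tm (b + 3)) = c"
      using that(3)[of 0] that(3)[of 1] that(3)[of 2] that(3)[of 3] by simp_all
    have "even (a + 1)" "even (b + 2)" using that(1,2) by simp_all
    from this[THEN tm_step_even] tm_step_even[OF that(2)]
    have "tm (b + 1) \<noteq> tm b" "tm (a + 2) \<noteq> tm (a + 1)" "tm (b + 3) \<noteq> tm (b + 2)"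
      by (simp_all add: numeral_2_eq_2 numeral_3_eq_3)
    with c tm_alternating_odd[OF that(1)] show False by argo
  qed
  show False
  proof (cases "odd a")
    case True
    then show ?thesis using assms(1) by (intro *[OF _ _ assms(2)]) simp_all
  next
    case False
    then show ?thesis using assms by (intro *[of b a]) auto
  qed
qed

text \<open>Comparing \<open>t\<close> with itself at an even distance is comparing its preimage under \<open>\<mu>\<close>, which is \<open>t\<close>
  again, at half the distance. The \<open>L\<close> letters of the preimage are the ones touched by the \<open>2 * L - 1\<close>
  positions, whatever the parity of \<open>a\<close>.\<close>
lemma tm_even_shift_halve:
  assumes "\<And>x. a \<le> x \<Longrightarrow> x < a + 2 * L - 1 \<Longrightarrow> (tm x \<noteq> tm (x + 2 * e)) = c" "i < L"
  shows "(tm (a div 2 + i) \<noteq> tm (a div 2 + e + i)) = c"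
proof -
  define x where "x = (if i = 0 then a else 2 * (a div 2 + i))"
  have x: "a \<le> x" "x < a + 2 * L - 1" "x div 2 = a div 2 + i" "(x + 2 * e) div 2 = a div 2 + e + i"
    using assms(2) by (auto simp: x_def)
  show ?thesis
    using assms(1)[OF x(1,2)] tm_rec[of x] tm_rec[of "x + 2 * e"] unfolding x(3,4) by auto
qed

text \<open>Halving turns the distance into one, and the bound of three positions for odd distances becomes a
  bound of six.\<close>
lemma tm_shift_2:
  assumes "\<And>j. j < 7 \<Longrightarrow> (tm (a + j) \<noteq> tm (a + 2 + j)) = c"
  shows False
proof -
  have "(tm x \<noteq> tm (x + 2 * 1)) = c" if "a \<le> x" "x < a + 2 * 4 - 1" for x
    using assms[of "x - a"] that by (simp add: add.commute)
  then have "(tm (a div 2 + i) \<noteq> tm (a div 2 + 1 + i)) = c" if "i < 4" for i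
    using that by (rule tm_even_shift_halve)
  moreover have "odd (b + (b + 1))" for b :: nat by presburger
  ultimately show False by (metis tm_odd_shift)
qed

text \<open>Halving reduces to an odd period, and odd periods larger than \<open>2\<close> contradict \<open>tm_odd_shift\<close>.\<close>
lemma thue_morse_overlap_free:
  assumes "0 < p" "\<And>j. j \<le> p \<Longrightarrow> tm (a + j) = tm (a + p + j)"
  shows False
  using assms
proof (induction p arbitrary: a rule: less_induct)
  case (less p)
  show False
  proof (cases "even p")
    case True
    then obtain e where e: "p = 2 * e" by blast
    have "(tm x \<noteq> tm (x + 2 * e)) = False" if "a \<le> x" "x < a + 2 * (e + 1) - 1" for x
      using less.prems(2)[of "x - a"] that e by (simp add: add.commute)
    then have "(tm (a div 2 + i) \<noteq> tm (a div 2 + e + i)) = False" if "i < e + 1" for i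
      using that by (rule tm_even_shift_halve)
    then have "tm (a div 2 + j) = tm (a div 2 + e + j)" if "j \<le> e" for j using that by simp
    then show False using less.IH[of e "a div 2"] less.prems(1) e by simp
  next
    case False
    show False
    proof (cases "p < 3")
      case True
      then have "p = 1" using False less.prems(1) by presburger
      then show False using less.prems(2)[of 0] less.prems(2)[of 1] tm_cube_free[of a] by simp
    next
      case False
      then show False
        using \<open>odd p\<close> less.prems(2) tm_odd_shift[of a "a + p" False] by simp
    qed
  qed
qed

section \<open>Reduction to odd lengths\<close>

lemma clipped_TM_eq: "clipped_TM l k a = map (\<lambda>j. tm (l + j) \<noteq> a) [0..<k]"
  by (auto simp: clipped_TM_def complement_def Let_def tm_def sdrop_snth intro!: nth_equalityI)

lemma \<mu>_eq: "\<mu> a = map (\<lambda>j. odd j \<noteq> a) [0..<2]"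
  by (simp add: \<mu>_def numeral_2_eq_2)

text \<open>In an image under \<open>\<mu>\<close>, a repetition of odd period \<open>p\<close> longer than \<open>2 * p\<close> would
  alternate on \<open>p + 1\<close> consecutive positions, because the translation by \<open>p\<close> moves the pairs \<open>01\<close> and \<open>10\<close> to
  positions of the other parity; but an alternating word does not have an odd period.\<close>
lemma cubefree_morphism_\<mu>: "cubefree_morphism \<mu>"
proof (rule cubefree_morphism_complementI[OF \<mu>_eq])
  fix v s L p
  let ?g = "blocks odd 2 v"
  assume p: "0 < p" "\<not> 2 dvd p" "p \<le> L" and "repetition ?g s L p"
  then have E: "?g x = ?g (x + p)" if "s \<le> x" "x + p < s + L" for x
    using that by (simp add: repetition_def)
  have pair: "?g (Suc x) = (\<not> ?g x)" if "even x" for x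
    using that by (elim evenE) (simp add: blocks_def)
  have "L \<le> 2 * p"
  proof (rule ccontr)
    assume L: "\<not> L \<le> 2 * p"
    have alt: "?g (Suc x) = (\<not> ?g x)" if "s \<le> x" "x < s + p" for x
    proof (cases "even x")
      case False
      then have "?g (Suc (x + p)) = (\<not> ?g (x + p))" using pair[of "x + p"] p by simp
      then show ?thesis using E[of x] E[of "Suc x"] that L by simp
    qed (rule pair)
    have "?g (s + j) = (?g s \<noteq> odd j)" if "j \<le> p" for j
      using that by (induction j) (simp_all add: alt)
    then have "?g (s + p) \<noteq> ?g s" using p(2) by simp
    moreover have "?g s = ?g (s + p)" using p(1) L by (intro E) simp_all
    ultimately show False by simp
  qed
  then show "real L \<le> 2 * real p" by (metis of_nat_le_iff of_nat_mult of_nat_numeral)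
qed simp_all

text \<open>\<open>t[2l..2l+2k-1]\<close> is the image of \<open>t[l..l+k-1]\<close> under \<open>\<mu>\<close>, and \<open>\<mu>\<close> commutes with complementation.\<close>
lemma morph_clipped_TM_double:
  assumes "0 < k"
  shows "morph (clipped_TM (2 * l) (2 * k)) w = morph \<mu> (morph (clipped_TM l k) w)"
proof (rule word_eqI)
  have len: "length (clipped_TM l k a) = k" "length (\<mu> a) = 2" for l k a
    by (simp_all add: clipped_TM_eq \<mu>_eq)
  have lenw: "wlength (morph (clipped_TM l k) w) = enat k * wlength w"
      "wlength (morph (clipped_TM (2 * l) (2 * k)) w) = enat (2 * k) * wlength w"
    using assms by (simp_all add: wlength_morph_uniform[OF len(1)])
  have len\<mu>: "wlength (morph \<mu> w') = enat 2 * wlength w'" for w'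
    by (rule wlength_morph_uniform[OF len(2)]) simp
  show wl: "wlength (morph (clipped_TM (2 * l) (2 * k)) w) =
      wlength (morph \<mu> (morph (clipped_TM l k) w))"
    unfolding len\<mu> lenw by (simp flip: times_enat_simps add: mult.assoc)
  fix i assume i: "enat i < wlength (morph \<mu> (morph (clipped_TM l k) w))"
  have i2: "enat (i div 2) < wlength (morph (clipped_TM l k) w)"
  proof (cases "wlength (morph (clipped_TM l k) w)")
    case (enat N)
    then show ?thesis using i by (simp add: len\<mu>)
  qed simp
  define j where "j = i div 2 mod k"
  have "j < k" using assms by (simp add: j_def)
  have "i mod (2 * k) = 2 * j + i mod 2" "i div (2 * k) = i div 2 div k"
    unfolding j_def by (rule mod_mult2_eq div_mult2_eq)+
  moreover have "2 * j + i mod 2 < 2 * k" using \<open>j < k\<close> by linarith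
  moreover have "tm (l * 2 + (2 * j + i mod 2)) = (tm (l + j) \<noteq> odd i)"
    using tm_rec[of "l * 2 + (2 * j + i mod 2)"] by (simp add: add.commute)
  ultimately have "letter (morph (clipped_TM (2 * l) (2 * k)) w) i =
      ((tm (l + j) \<noteq> odd i) \<noteq> letter w (i div 2 div k))"
    using assms by (subst letter_morph_uniform[OF len(1) _ i[folded wl]]) (simp_all add: clipped_TM_eq mult.commute)
  moreover have "letter (morph \<mu> (morph (clipped_TM l k) w)) i =
      (odd i \<noteq> letter (morph (clipped_TM l k) w) (i div 2))"
    by (subst letter_morph_uniform[OF len(2) _ i]) (auto simp: \<mu>_eq)
  moreover have "letter (morph (clipped_TM l k) w) (i div 2) = (tm (l + j) \<noteq> letter w (i div 2 div k))"
    by (subst letter_morph_uniform[OF len(1) assms i2]) (use \<open>j < k\<close> in \<open>simp add: clipped_TM_eq flip: j_def\<close>)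
  ultimately show "letter (morph (clipped_TM (2 * l) (2 * k)) w) i =
      letter (morph \<mu> (morph (clipped_TM l k) w)) i"
    by argo
qed

lemma cubefree_clipped_TM_power:
  assumes "cubefree_morphism (clipped_TM l m)" "0 < m"
  shows "cubefree_morphism (clipped_TM (l * 2 ^ n) (m * 2 ^ n))"
proof (induction n)
  case (Suc n)
  have "l * 2 ^ Suc n = 2 * (l * 2 ^ n)" "m * 2 ^ Suc n = 2 * (m * 2 ^ n)" by simp_all
  moreover have "0 < m * 2 ^ n" using assms(2) by simp
  ultimately show ?case
    using cubefree_morphism_\<mu> Suc.IH
    unfolding cubefree_morphism_def by (simp only: morph_clipped_TM_double) blast
qed (simp add: assms)

section \<open>Cubes for lengths three times a power of two\<close>

definition two_blocks :: "nat \<Rightarrow> nat \<Rightarrow> bool \<Rightarrow> bool \<Rightarrow> nat \<Rightarrow> bool" where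
  "two_blocks l k a b i = (if i < k then tm (l + i) \<noteq> a else tm (l + i - k) \<noteq> b)"

text \<open>The image of the two-letter word \<open>ab\<close> contains a cube for some \<open>a\<close> and \<open>b\<close>; two-letter words are
  cubefree.\<close>
definition pair_image_cube :: "nat \<Rightarrow> nat \<Rightarrow> bool" where
  "pair_image_cube l k \<longleftrightarrow> (\<exists>a b s p. 0 < p \<and> s + 3 * p \<le> 2 * k \<and>
     repetition (two_blocks l k a b) s (3 * p) p)"

lemma pair_image_cube_double:
  assumes "pair_image_cube l k" shows "pair_image_cube (2 * l) (2 * k)"
proof -
  obtain a b s p where c: "0 < p" "s + 3 * p \<le> 2 * k" "repetition (two_blocks l k a b) s (3 * p) p"
    using assms unfolding pair_image_cube_def by blast
  have half: "two_blocks (2 * l) (2 * k) a b i = (two_blocks l k a b (i div 2) \<noteq> odd i)" for i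
  proof (cases "i < 2 * k")
    case True
    then show ?thesis using tm_rec[of "2 * l + i"] by (auto simp: two_blocks_def)
  next
    case False
    then have "(2 * l + i - 2 * k) div 2 = l + i div 2 - k" "odd (2 * l + i - 2 * k) = odd i" "\<not> i div 2 < k"
      by auto
    with False show ?thesis using tm_rec[of "2 * l + i - 2 * k"] by (auto simp: two_blocks_def)
  qed
  have "repetition (two_blocks (2 * l) (2 * k) a b) (2 * s) (3 * (2 * p)) (2 * p)"
    unfolding repetition_def
  proof (intro allI impI)
    fix i assume "2 * s \<le> i" "i + 2 * p < 2 * s + 3 * (2 * p)"
    then have "s \<le> i div 2" "i div 2 + p < s + 3 * p" by linarith+
    then show "two_blocks (2 * l) (2 * k) a b i = two_blocks (2 * l) (2 * k) a b (i + 2 * p)"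
      using c(3) by (simp add: half repetition_def add.commute)
  qed
  then show ?thesis using c(1,2) unfolding pair_image_cube_def
    by (intro exI[of _ a] exI[of _ b] exI[of _ "2 * s"] exI[of _ "2 * p"]) simp
qed

text \<open>A square of a letter at the beginning or end of the block becomes a cube if the neighbouring block is
  complemented suitably.\<close>
lemma pair_image_cube_period_1:
  assumes "2 \<le> k" and "tm l = tm (l + 1) \<or> tm (l + k - 2) = tm (l + k - 1)"
  shows "pair_image_cube l k"
  using assms(2)
proof
  let ?a = "tm (l + k - 1) \<noteq> tm l"
  assume "tm l = tm (l + 1)"
  then have "repetition (two_blocks l k ?a False) (k - 1) (3 * 1) 1"
    unfolding repetition_def
  proof (intro allI impI)
    fix i assume "k - 1 \<le> i" "i + 1 < k - 1 + 3 * 1"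
    then have "i = k - 1 \<or> i = k" using assms(1) by linarith
    then show "two_blocks l k ?a False i = two_blocks l k ?a False (i + 1)"
      using assms(1) \<open>tm l = tm (l + 1)\<close> by (auto simp: two_blocks_def)
  qed
  then show ?thesis using assms(1) unfolding pair_image_cube_def
    by (intro exI[of _ ?a] exI[of _ False] exI[of _ "k - 1"] exI[of _ 1]) simp
next
  let ?b = "tm (l + k - 1) \<noteq> tm l"
  assume *: "tm (l + k - 2) = tm (l + k - 1)"
  have "repetition (two_blocks l k False ?b) (k - 2) (3 * 1) 1"
    unfolding repetition_def
  proof (intro allI impI)
    fix i assume "k - 2 \<le> i" "i + 1 < k - 2 + 3 * 1"
    then have "i = k - 2 \<or> i = k - 1" using assms(1) by linarith
    then show "two_blocks l k False ?b i = two_blocks l k False ?b (i + 1)"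
    proof
      assume "i = k - 2"
      moreover have "Suc (k - 2) = k - 1" "Suc (l + k - 2) = l + k - 1" using assms(1) by simp_all
      ultimately show ?thesis using assms(1) * by (simp add: two_blocks_def)
    next
      assume "i = k - 1"
      then show ?thesis using assms(1) by (auto simp: two_blocks_def)
    qed
  qed
  then show ?thesis using assms(1) unfolding pair_image_cube_def
    by (intro exI[of _ False] exI[of _ ?b] exI[of _ "k - 2"] exI[of _ 1]) simp
qed

text \<open>For odd \<open>l\<close> and even \<open>k\<close> both ends of the block cut through a pair \<open>t[2i..2i+1]\<close>. If the first two
  letters differ and the last two letters differ, the two pairs of letters of the preimage at the ends
  are squares. Squares of letters start at odd positions only, so their distance \<open>k / 2 - 1\<close> is
  even, which leaves only \<open>k = 6\<close>.\<close>
lemma pair_image_cube_three_power: "pair_image_cube l (3 * 2 ^ n)"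
proof (induction n arbitrary: l)
  case 0
  show ?case
  proof (cases "tm l = tm (l + 1) \<or> tm (l + 1) = tm (l + 2)")
    case True
    then show ?thesis using pair_image_cube_period_1[of 3 l] by simp
  next
    case False
    have "repetition (two_blocks l 3 False True) 0 (3 * 2) 2"
      unfolding repetition_def
    proof (intro allI impI)
      fix i :: nat assume "i + 2 < 0 + 3 * 2"
      then have "i = 0 \<or> i = 1 \<or> i = 2 \<or> i = 3" by linarith
      then show "two_blocks l 3 False True i = two_blocks l 3 False True (i + 2)"
        using False by (auto simp: two_blocks_def)
    qed
    then show ?thesis unfolding pair_image_cube_def
      by (intro exI[of _ False] exI[of _ True] exI[of _ 0] exI[of _ 2]) simp
  qed
next
  case (Suc n)
  let ?k = "3 * 2 ^ n :: nat"
  have k: "3 * 2 ^ Suc n = 2 * ?k" "3 \<le> ?k" by simp_all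
  show ?case
  proof (cases "even l")
    case True
    then show ?thesis using pair_image_cube_double[OF Suc.IH[of "l div 2"]] k(1) by simp
  next
    case False
    then obtain i where l: "l = Suc (2 * i)" by (elim oddE) simp
    show ?thesis
    proof (cases "tm l = tm (l + 1) \<or> tm (l + 2 * ?k - 2) = tm (l + 2 * ?k - 1)")
      case True
      then show ?thesis unfolding k(1) using k(2) by (intro pair_image_cube_period_1) auto
    next
      case no_square: False
      have half: "Suc (2 * i) + 2 * K - 2 = Suc (2 * (i + K - 1))" "Suc (2 * i) + 2 * K - 1 = 2 * (i + K)"
        if "3 \<le> K" for K :: nat using that by (linarith, simp)
      have idx: "l + 1 = 2 * (i + 1)" "l + 2 * ?k - 2 = Suc (2 * (i + ?k - 1))" "l + 2 * ?k - 1 = 2 * (i + ?k)"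
        unfolding l using half[OF k(2)] by simp_all
      have "tm l = (\<not> tm i)" by (simp add: l)
      then have eq: "tm i = tm (i + 1)" "tm (i + ?k - 1) = tm (i + ?k)"
        using no_square unfolding idx tm_even tm_odd by blast+
      have "odd i" using eq(1) tm_step_even[of i] by auto
      moreover have "Suc (i + ?k - 1) = i + ?k" using k(2) by linarith
      then have "odd (i + ?k - 1)" using eq(2) tm_step_even[of "i + ?k - 1"] by metis
      ultimately have "odd ?k" using k(2) by presburger
      then have n: "n = 0" by simp
      obtain z where i: "i = Suc (2 * z)" using \<open>odd i\<close> by (elim oddE) simp
      \<comment> \<open>this determines the block up to complement: it is \<open>010010\<close>, and \<open>010\<close> followed by the complement \<open>101\<close> is \<open>(01)\<^sup>3\<close>\<close>
      have idx2: "i + 1 = 2 * (z + 1)" "i + 2 = Suc (2 * (z + 1))" "i + 3 = 2 * (z + 2)"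
        "l + 2 = Suc (2 * (i + 1))" "l + 3 = 2 * (i + 2)" "l + 4 = Suc (2 * (i + 2))" "l + 5 = 2 * (i + 3)"
        by (simp_all add: i l)
      have tmi: "tm i = (\<not> tm z)" "tm (i + 1) = tm (z + 1)" "tm (i + 2) = (\<not> tm (z + 1))" "tm (i + 3) = tm (z + 2)"
        unfolding idx2 tm_even tm_odd by (simp_all add: i)
      have tml: "tm l = (\<not> tm i)" "tm (l + 1) = tm (i + 1)" "tm (l + 2) = (\<not> tm (i + 1))"
        "tm (l + 3) = tm (i + 2)" "tm (l + 4) = (\<not> tm (i + 2))" "tm (l + 5) = tm (i + 3)"
        unfolding idx2 idx(1) tm_even tm_odd by (simp_all add: l)
      have "repetition (two_blocks l 6 False True) 3 (3 * 2) 2"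
        unfolding repetition_def
      proof (intro allI impI)
        fix j :: nat assume "3 \<le> j" "j + 2 < 3 + 3 * 2"
        then have "j = 3 \<or> j = 4 \<or> j = 5 \<or> j = 6" by linarith
        then show "two_blocks l 6 False True j = two_blocks l 6 False True (j + 2)"
          using eq n tmi tml arg_cong[OF add.commute[of l 5], of tm] by (auto simp: two_blocks_def)
      qed
      then show ?thesis using n unfolding pair_image_cube_def
        by (intro exI[of _ False] exI[of _ True] exI[of _ 3] exI[of _ 2]) simp
    qed
  qed
qed

lemma not_cubefree_morphism_three_power: "\<not> cubefree_morphism (clipped_TM l (3 * 2 ^ n))"
proof
  let ?k = "3 * 2 ^ n :: nat"
  assume mor: "cubefree_morphism (clipped_TM l ?k)"
  obtain a b s p where c: "0 < p" "s + 3 * p \<le> 2 * ?k" "repetition (two_blocks l ?k a b) s (3 * p) p"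
    using pair_image_cube_three_power[of l n] unfolding pair_image_cube_def by blast
  have "cubefree (Fin [a, b])" unfolding cubefree_iff
    by (intro exI[of _ 2]) auto
  then have "cubefree (morph (clipped_TM l ?k) (Fin [a, b]))" using mor unfolding cubefree_morphism_def by blast
  then obtain c' where c': "c' < 3" "real (3 * p) \<le> c' * real p"
  proof -
    have "letter (morph (clipped_TM l ?k) (Fin [a, b])) i = two_blocks l ?k a b i" if "i < 2 * ?k" for i
      using that by (auto simp: clipped_TM_eq two_blocks_def nth_append)
    then have "repetition (letter (morph (clipped_TM l ?k) (Fin [a, b]))) s (3 * p) p"
      using c(2,3) unfolding repetition_def by simp
    moreover have "enat (s + 3 * p) \<le> wlength (morph (clipped_TM l ?k) (Fin [a, b]))"
      using c(2) by (simp add: clipped_TM_eq)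
    moreover have "p \<le> 3 * p" by simp
    ultimately show ?thesis
      using \<open>cubefree (morph (clipped_TM l ?k) (Fin [a, b]))\<close> c(1) that unfolding cubefree_iff by blast
  qed
  have "c' * real p < 3 * real p" using c'(1) c(1) by simp
  then show False using c'(2) by simp
qed

section \<open>Synchronization\<close>

lemma blocks_shift:
  assumes "0 < k"
  shows "blocks u k v (i * k + x) = blocks u k (\<lambda>j. v (i + j)) x"
  using assms by (simp add: blocks_def)

lemma repetition_mono:
  "repetition f s L p \<Longrightarrow> s \<le> s' \<Longrightarrow> s' + L' \<le> s + L \<Longrightarrow> repetition f s' L' p"
  by (simp add: repetition_def)

lemma repetition_blocks_mod:
  assumes "0 < k" "repetition (blocks u k v) s L p"
  shows "repetition (blocks u k (\<lambda>j. v (s div k + j))) (s mod k) L p"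
  unfolding repetition_def
proof (intro allI impI)
  fix x assume x: "s mod k \<le> x" "x + p < s mod k + L"
  have "s = s div k * k + s mod k" by simp
  then have "s \<le> s div k * k + x" "s div k * k + x + p < s + L" using x by linarith+
  then have "blocks u k v (s div k * k + x) = blocks u k v (s div k * k + (x + p))"
    using assms(2) by (simp add: repetition_def add.assoc)
  then show "blocks u k (\<lambda>j. v (s div k + j)) x = blocks u k (\<lambda>j. v (s div k + j)) (x + p)"
    unfolding blocks_shift[OF assms(1)] .
qed

text \<open>No block of an image occurs in it out of phase. A block that starts at offset \<open>r\<close> in another one lies
  over the last \<open>k - r\<close> letters of that block and the first \<open>r\<close> letters of the next, and it cannot
  agree with both, whatever the complementations \<open>c\<close> and \<open>d\<close> are.\<close>
definition synchronizing :: "(nat \<Rightarrow> bool) \<Rightarrow> nat \<Rightarrow> bool" where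
  "synchronizing u k \<longleftrightarrow> (\<forall>r c d. 0 < r \<longrightarrow> r < k \<longrightarrow>
     \<not> ((\<forall>j < k - r. (u j \<noteq> u (j + r)) = c) \<and> (\<forall>j < r. (u (k - r + j) \<noteq> u j) = d)))"

text \<open>A window of \<open>2 * k - 1\<close> positions contains a complete block, and its translate by \<open>p\<close> would be out of
  phase.\<close>
lemma synchronizing_repetition:
  assumes "synchronizing u k" "0 < k" "\<not> k dvd p" "repetition (blocks u k v) s L p"
  shows "L < p + 2 * k - 1"
proof (rule ccontr)
  assume L: "\<not> L < p + 2 * k - 1"
  define i where "i = (s + k - 1) div k"
  have "s + k - 1 < i * k + k" "i * k \<le> s + k - 1"
    unfolding i_def using \<open>0 < k\<close> by (simp_all add: div_times_less_eq_dividend dividend_less_div_times add.commute)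
  then have i: "s \<le> i * k" "i * k + k \<le> s + 2 * k - 1" using \<open>0 < k\<close> by linarith+
  define q r where "q = p div k" and "r = p mod k"
  have p: "p = q * k + r" by (simp add: q_def r_def)
  have r: "0 < r" "r < k" using assms(2,3) by (auto simp: r_def dvd_eq_mod_eq_0)
  have E: "blocks u k v (i * k + j) = blocks u k v (i * k + j + p)" if "j < k" for j
    using assms(4) i L that \<open>0 < k\<close> unfolding repetition_def by simp
  have "(u j \<noteq> u (j + r)) = (v i \<noteq> v (i + q))" if "j < k - r" for j
  proof -
    have "i * k + j + p = (i + q) * k + (j + r)" "j < k" "j + r < k"
      using that by (simp_all add: p algebra_simps)
    then show ?thesis using E[of j] by (simp only: blocks_at) blast
  qed
  moreover have "(u (k - r + j) \<noteq> u j) = (v i \<noteq> v (i + q + 1))" if "j < r" for j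
  proof -
    have "i * k + (k - r + j) + p = (i + q + 1) * k + j" "k - r + j < k" "j < k"
      using that r by (simp_all add: p algebra_simps)
    then show ?thesis using E[of "k - r + j"] by (simp only: blocks_at) blast
  qed
  ultimately show False using assms(1) r unfolding synchronizing_def by blast
qed

text \<open>Periods above \<open>k\<close> satisfy \<open>L \<le> p + 2k - 2 \<le> (3 - 1/k) p\<close>, and for the finitely many periods below
  \<open>k\<close> having no cube gives \<open>L \<le> 3p - 1 \<le> (3 - 1/k) p\<close>. It suffices to look at cubes that start in the first
  block.\<close>
lemma cubefree_morphism_synchronizingI:
  assumes h: "\<And>a. h a = map (\<lambda>j. u j \<noteq> a) [0..<k]" and k: "0 < k"
    and sync: "synchronizing u k"
    and short: "\<And>v r p. 0 < p \<Longrightarrow> p < k \<Longrightarrow> r < k \<Longrightarrow> \<not> repetition (blocks u k v) r (3 * p) p"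
  shows "cubefree_morphism h"
proof (rule cubefree_morphism_complementI[OF h k])
  show "3 - 1 / real k < 3" using k by simp
  fix v s L p
  assume p: "0 < p" "\<not> k dvd p" "p \<le> L" and rep: "repetition (blocks u k v) s L p"
  show "real L \<le> (3 - 1 / real k) * real p"
  proof (cases "p < k")
    case True
    have "L < 3 * p"
    proof (rule ccontr)
      assume "\<not> L < 3 * p"
      then have "repetition (blocks u k v) s (3 * p) p" by (intro repetition_mono[OF rep]) auto
      from repetition_blocks_mod[OF k this]
      show False using short[OF p(1) True] k by simp
    qed
    then have "real L \<le> 3 * real p - 1" by linarith
    moreover have "real p / real k \<le> 1" using True k by simp
    ultimately show ?thesis by (simp add: algebra_simps)
  next
    case False
    have "real L \<le> real p + 2 * real k - 2"
      using synchronizing_repetition[OF sync k p(2) rep] k by linarith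
    moreover have "(2 - 1 / real k) * real k \<le> (2 - 1 / real k) * real p"
      using False k by (intro mult_left_mono) (simp_all add: field_simps)
    ultimately show ?thesis using k by (simp add: algebra_simps)
  qed
qed

text \<open>As \<open>k\<close> is odd, one of the two distances \<open>r\<close> and \<open>k - r\<close> is odd, so the overlap at that distance,
  whose length is the other one, has length at most three and hence exactly two. Then the overlap at
  distance two has length \<open>k - 2 \<ge> 7\<close>, which contradicts \<open>tm_shift_2\<close>.\<close>
lemma synchronizing_tm:
  assumes "odd k" "9 \<le> k"
  shows "synchronizing (\<lambda>j. tm (l + j)) k"
  unfolding synchronizing_def
proof (intro allI impI notI, elim conjE)
  fix r c d
  assume r: "0 < r" "r < k"
    and c: "\<forall>j < k - r. (tm (l + j) \<noteq> tm (l + (j + r))) = c"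
    and d: "\<forall>j < r. (tm (l + (k - r + j)) \<noteq> tm (l + j)) = d"
  show False
  proof (cases "odd r")
    case True
    have "k - r < 4"
    proof (rule ccontr)
      assume "\<not> k - r < 4"
      then have "(tm (l + j) \<noteq> tm (l + r + j)) = c" if "j < 4" for j
        using c that by (simp add: add_ac)
      then show False using True by (intro tm_odd_shift[of l "l + r"]) auto
    qed
    then have "k - r = 2" using True r assms(1) by presburger
    have "(tm (l + j) \<noteq> tm (l + 2 + j)) = d" if "j < 7" for j
    proof -
      have "j < r" "l + (k - r + j) = l + 2 + j" using \<open>k - r = 2\<close> that assms(2) by linarith+
      then show ?thesis using d by metis
    qed
    then show False by (rule tm_shift_2)
  next
    case False
    have "r < 4"
    proof (rule ccontr)
      assume "\<not> r < 4"
      then have "(tm (l + (k - r) + j) \<noteq> tm (l + j)) = d" if "j < 4" for j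
        using d that by (simp add: add_ac)
      then show False using False assms(1) r by (intro tm_odd_shift[of "l + (k - r)" l]) auto
    qed
    then have "r = 2" using False r by presburger
    then have "(tm (l + j) \<noteq> tm (l + 2 + j)) = c" if "j < 7" for j
      using c that assms(2) by (simp add: add_ac)
    then show False by (rule tm_shift_2)
  qed
qed

section \<open>Cubes of period below the block length\<close>

text \<open>A cube of period \<open>p = a + b\<close> that ends \<open>p + b\<close> letters after a boundary between two blocks. Its
  first \<open>2 * p\<close> letters are compared with their translates: the first \<open>a\<close> within the left block,
  then \<open>p\<close> letters with a position in the right block, where only the relative complementation \<open>c\<close> of
  the blocks is free, and finally \<open>b\<close> within the right block.\<close>
definition boundary_cube :: "nat \<Rightarrow> nat \<Rightarrow> nat \<Rightarrow> nat \<Rightarrow> bool" where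
  "boundary_cube l k a b \<longleftrightarrow>
     (\<forall>j < a. tm (l + k - (a + b) - a + j) = tm (l + k - a + j)) \<and>
     (\<exists>c. \<forall>j < a + b. (tm (l + k - (a + b) + j) \<noteq> tm (l + j)) = c) \<and>
     (\<forall>j < b. tm (l + j) = tm (l + (a + b) + j))"

text \<open>The \<open>2 * p\<close> positions that are compared with their translates run alternately through stretches of
  length \<open>k - p\<close>, compared within one block at distance \<open>p\<close> (\<open>S0\<close>, \<open>S1\<close>), and stretches of length \<open>p\<close>,
  compared with the next block at distance \<open>k - p\<close> (\<open>C0\<close>, \<open>C1\<close>). Exactly one of the two distances is odd,
  and a stretch at odd distance can be met in at most three positions; by overlap-freeness, a stretch
  within one block is met in at most \<open>p\<close> positions. What remains is a window that contains a whole
  stretch of length \<open>p\<close> and at most three positions on either side of it. The parity argument does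
  not apply to stretches within a block if \<open>k - p = 2\<close>, as they are too short; then the others are
  compared at distance two, and \<open>tm_shift_2\<close> applies.\<close>
lemma short_cube_window:
  assumes k: "odd k" "9 \<le> k" and p: "0 < p" "p < k" and r: "r < k"
    and S0: "\<And>z. r \<le> z \<Longrightarrow> z < r + 2 * p \<Longrightarrow> z + p < k \<Longrightarrow> tm (l + z) = tm (l + z + p)"
    and C0: "\<And>z. r \<le> z \<Longrightarrow> z < r + 2 * p \<Longrightarrow> k \<le> z + p \<Longrightarrow> z < k \<Longrightarrow>
      (tm (l + z) \<noteq> tm (l + z + p - k)) = c"
    and S1: "\<And>z. r \<le> k + z \<Longrightarrow> k + z < r + 2 * p \<Longrightarrow> z + p < k \<Longrightarrow> tm (l + z) = tm (l + z + p)"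
    and C1: "\<And>z. r \<le> k + z \<Longrightarrow> k + z < r + 2 * p \<Longrightarrow> k \<le> z + p \<Longrightarrow> z < k \<Longrightarrow>
      (tm (l + z) \<noteq> tm (l + z + p - k)) = c'"
  shows "p \<in> {1, 2, 3, 5} \<and> r \<le> k - p \<and> k - p \<le> r + p \<and> k - p \<le> r + 3 \<and> r + 2 * p \<le> k + 3"
proof -
  have S: False if "\<And>j. j \<le> p \<Longrightarrow> tm (l + (z + j)) = tm (l + (z + j) + p)" for z
    using that by (intro thue_morse_overlap_free[OF p(1), of "l + z"]) (simp add: add_ac)
  have S0': False if "r \<le> z" "z + p < k - p" "z < r + p" for z
    using that by (intro S[of z] S0) auto
  have S1': False if "r \<le> k + z" "z + p < k - p" "k + z < r + p" for z
    using that by (intro S[of z] S1) auto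
  have S_odd: False if "odd p" "\<And>j. j < 4 \<Longrightarrow> tm (l + (z + j)) = tm (l + (z + j) + p)" for z
    using that by (intro tm_odd_shift[of "l + z" "l + z + p" False]) (auto simp: add_ac)
  have S0_odd: False if "odd p" "r \<le> z" "z + 3 < k - p" "z + 3 < r + 2 * p" for z
    using that by (intro S_odd[of z] S0) auto
  have S1_odd: False if "odd p" "r \<le> k + z" "z + 3 < k - p" "k + z + 3 < r + 2 * p" for z
    using that by (intro S_odd[of z] S1) auto
  have C_odd: False if "even p" "k \<le> z + p"
    and C: "\<And>j. j < 4 \<Longrightarrow> (tm (l + (z + j)) \<noteq> tm (l + (z + j) + p - k)) = d" for z d
  proof (rule tm_odd_shift)
    have "(l + z) + (l + z + p - k) + k = 2 * (l + z) + p" using that(2) by simp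
    then show "odd ((l + z) + (l + z + p - k))" using that(1) k(1) by (metis dvd_triv_left even_add)
    show "(tm (l + z + j) \<noteq> tm (l + z + p - k + j)) = d" if "j < 4" for j
    proof -
      have *: "l + z + j = l + (z + j)" "l + z + p - k + j = l + (z + j) + p - k" using \<open>k \<le> z + p\<close> by simp_all
      show ?thesis unfolding * by (rule C[OF that])
    qed
  qed
  have C0_odd: False if "even p" "r \<le> z" "k \<le> z + p" "z + 3 < k" "z + 3 < r + 2 * p" for z
    using that by (intro C_odd[of z c] C0) auto
  have C1_odd: False if "even p" "r \<le> k + z" "k \<le> z + p" "z + 3 < k" "k + z + 3 < r + 2 * p" for z
    using that by (intro C_odd[of z c'] C1) auto
  show ?thesis
  proof (cases "even p")
    case True
    have "p = 2"
    proof (rule ccontr)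
      assume "p \<noteq> 2"
      then have "4 \<le> p" using True p(1) by presburger
      show False
      proof (cases "r \<le> k - p")
        case True
        then show False using S0'[of r] C0_odd[of "k - p"] \<open>even p\<close> \<open>4 \<le> p\<close> p by fastforce
      next
        case False
        have "k \<le> r + 3" using C0_odd[of r] False \<open>even p\<close> \<open>4 \<le> p\<close> p by fastforce
        moreover have "k \<le> 2 * p" using S1'[of 0] r False by fastforce
        moreover have "r + 3 * p \<le> 2 * k + 3" using C1_odd[of "k - p"] r \<open>even p\<close> \<open>4 \<le> p\<close> p by fastforce
        ultimately have "3 * p \<le> k + 6" "k \<le> 2 * p" by linarith+
        then have "p = 5 \<or> p = 6" using k(2) by linarith
        then have "p = 6" using \<open>even p\<close> by auto
        then have "k = 12" using \<open>3 * p \<le> k + 6\<close> \<open>k \<le> 2 * p\<close> by linarith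
        then show False using k(1) by simp
      qed
    qed
    moreover have "r \<le> k - 2" using S1'[of 0] r k(2) \<open>p = 2\<close> by fastforce
    moreover have "k - 4 \<le> r" using S0'[of r] k(2) \<open>p = 2\<close> by fastforce
    ultimately show ?thesis using k(2) by auto
  next
    case False
    show ?thesis
    proof (cases "k - p < 4")
      case True
      have kp: "k = p + 2" using True False k(1) p by presburger
      have idx: "l + (j + 2) + p - k = l + j" "l + (j + 2) = l + 2 + j" for j using kp by simp_all
      have c0: "(tm (l + j) \<noteq> tm (l + 2 + j)) = c" if "r \<le> j + 2" "r \<le> 3" "j < 7" for j
        using C0[of "j + 2"] that kp k(2) unfolding idx by auto
      have c1: "(tm (l + j) \<noteq> tm (l + 2 + j)) = c'" if "r \<ge> 3" "j < 7" "j + 6 < r + k" for j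
        using C1[of "j + 2"] that kp k(2) r unfolding idx by auto
      \<comment> \<open>the first of the two crossing stretches may be incomplete on the left and the second one on the right, but they compare the same positions of \<open>u\<close>, every such position occurs in one of them, and some position in both\<close>
      have "\<exists>c. \<forall>j < 7. (tm (l + j) \<noteq> tm (l + 2 + j)) = c"
      proof (cases "r \<le> 2")
        case True
        then have "(tm (l + j) \<noteq> tm (l + 2 + j)) = c" if "j < 7" for j using c0[of j] that by simp
        then show ?thesis by blast
      next
        case False
        have "(tm (l + j) \<noteq> tm (l + 2 + j)) = c'" if "j < 7" for j
        proof (cases "j + 6 < r + k")
          case False
          then have j: "r = 3" "1 \<le> j" using that \<open>\<not> r \<le> 2\<close> k(2) by linarith+
          then have "c = c'" using c0[of 1] c1[of 1] k(2) by simp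
          then show ?thesis using c0[of j] j that by simp
        qed (use c1 that False in simp)
        then show ?thesis by blast
      qed
      then show ?thesis using tm_shift_2 by metis
    next
      case kp: False
      have r_le: "r \<le> k - p"
      proof (rule ccontr)
        assume r': "\<not> r \<le> k - p"
        then have "k - p \<le> p" using S1'[of 0] r p by fastforce
        then show False using S1_odd[of 0] \<open>odd p\<close> kp r r' p by fastforce
      qed
      have a: "k - p \<le> r + p" using S0'[of r] p by fastforce
      have a': "k - p \<le> r + 3"
      proof (rule ccontr)
        assume r': "\<not> k - p \<le> r + 3"
        then show False using S0_odd[of r] \<open>odd p\<close> a by fastforce
      qed
      have b: "r + 2 * p \<le> k + 3"
      proof (rule ccontr)
        assume r': "\<not> r + 2 * p \<le> k + 3"
        then show False using S1_odd[of 0] \<open>odd p\<close> kp r by fastforce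
      qed
      have "p \<le> 6" using r_le a a' b p by linarith
      then have "p = 1 \<or> p = 3 \<or> p = 5" using \<open>odd p\<close> by presburger
      then show ?thesis using r_le a a' b by blast
    qed
  qed
qed

lemma short_cube_boundary:
  assumes k: "odd k" "9 \<le> k" and p: "0 < p" "p < k" and r: "r < k"
    and rep: "repetition (blocks (\<lambda>j. tm (l + j)) k v) r (3 * p) p"
  obtains a b where "a \<le> 3" "b \<le> 3" "a + b \<in> {1, 2, 3, 5}" "boundary_cube l k a b"
proof -
  let ?g = "blocks (\<lambda>j. tm (l + j)) k v"
  have E: "?g z = ?g (z + p)" if "r \<le> z" "z < r + 2 * p" for z
    using rep that by (simp add: repetition_def)
  have g: "?g j = (tm (l + j) \<noteq> v 0)" "?g (k + j) = (tm (l + j) \<noteq> v 1)"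
    "?g (2 * k + j) = (tm (l + j) \<noteq> v 2)" if "j < k" for j
    using that blocks_at[of j k "\<lambda>j. tm (l + j)" v 0] blocks_at[of j k "\<lambda>j. tm (l + j)" v 1]
      blocks_at[of j k "\<lambda>j. tm (l + j)" v 2] by simp_all
  have S0: "tm (l + z) = tm (l + z + p)" if "r \<le> z" "z < r + 2 * p" "z + p < k" for z
    using E[OF that(1,2)] g(1)[of z] g(1)[of "z + p"] that(3) by (simp add: add.assoc) blast
  have C0: "(tm (l + z) \<noteq> tm (l + z + p - k)) = (v 0 \<noteq> v 1)"
    if "r \<le> z" "z < r + 2 * p" "k \<le> z + p" "z < k" for z
  proof -
    have "z + p = k + (z + p - k)" "z + p - k < k" "l + (z + p - k) = l + z + p - k" using that p by simp_all
    then show ?thesis using E[OF that(1,2)] g(1)[OF that(4)] g(2)[of "z + p - k"] by metis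
  qed
  have S1: "tm (l + z) = tm (l + z + p)" if "r \<le> k + z" "k + z < r + 2 * p" "z + p < k" for z
    using E[OF that(1,2)] g(2)[of z] g(2)[of "z + p"] that(3) by (simp add: add.assoc) blast
  have C1: "(tm (l + z) \<noteq> tm (l + z + p - k)) = (v 1 \<noteq> v 2)"
    if "r \<le> k + z" "k + z < r + 2 * p" "k \<le> z + p" "z < k" for z
  proof -
    have "k + z + p = 2 * k + (z + p - k)" "z + p - k < k" "l + (z + p - k) = l + z + p - k" using that p by simp_all
    then show ?thesis using E[OF that(1,2)] g(2)[OF that(4)] g(3)[of "z + p - k"] by metis
  qed
  have w: "p \<in> {1, 2, 3, 5}" "r \<le> k - p" "k - p \<le> r + p" "k - p \<le> r + 3" "r + 2 * p \<le> k + 3"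
    using short_cube_window[OF k p r S0 C0 S1 C1] by blast+
  define a b where "a = k - p - r" and "b = r + 2 * p - k"
  have ab: "a \<le> 3" "b \<le> 3" "a + b = p" "r + a + p = k" using w(2-5) p by (auto simp: a_def b_def)
  have "boundary_cube l k a b"
    unfolding boundary_cube_def ab(3)
  proof (intro conjI allI impI exI)
    show "tm (l + k - p - a + j) = tm (l + k - a + j)" if "j < a" for j
    proof -
      have "l + k - p - a + j = l + (r + j)" "l + k - a + j = l + (r + j) + p" using ab by auto
      then show ?thesis using S0[of "r + j"] that ab by simp
    qed
    show "(tm (l + k - p + j) \<noteq> tm (l + j)) = (v 0 \<noteq> v 1)" if "j < p" for j
    proof -
      have "l + k - p + j = l + (r + a + j)" "l + j = l + (r + a + j) + p - k" using ab by auto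
      then show ?thesis using C0[of "r + a + j"] that ab by simp
    qed
    show "tm (l + j) = tm (l + p + j)" if "j < b" for j
    proof -
      have "r \<le> k + j" "k + j < r + 2 * p" "j + p < k" using that ab r k(2) by auto
      then show ?thesis using S1[of j] by (simp add: add_ac)
    qed
  qed
  with ab w(1) that show ?thesis by blast
qed

lemma cubefree_clipped_TM_oddI:
  assumes "odd k" "9 \<le> k"
    and "\<And>a b. a \<le> 3 \<Longrightarrow> b \<le> 3 \<Longrightarrow> a + b \<in> {1, 2, 3, 5} \<Longrightarrow> \<not> boundary_cube l k a b"
  shows "cubefree_morphism (clipped_TM l k)"
proof (rule cubefree_morphism_synchronizingI[OF clipped_TM_eq])
  show "0 < k" using assms(2) by simp
  show "synchronizing (\<lambda>j. tm (l + j)) k" by (rule synchronizing_tm[OF assms(1,2)])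
  fix v r p assume "0 < p" "p < k" "r < k"
  then show "\<not> repetition (blocks (\<lambda>j. tm (l + j)) k v) r (3 * p) p"
    using short_cube_boundary[OF assms(1,2)] assms(3) by metis
qed

section \<open>Letters at the ends of the block\<close>

text \<open>Conditions on the first eight and the last seven letters of the block that exclude boundary cubes of
  period \<open>1\<close>, \<open>2\<close>, \<open>3\<close> and \<open>5\<close>. For period three it is the comparison of the two blocks with each
  other that has to fail, for the other periods a comparison within one of them.\<close>
lemma cubefree_clipped_TM_boundaryI:
  assumes "odd k" "9 \<le> k" and n: "l + k = n"
    and 1: "tm l \<noteq> tm (l + 1)" "tm (n - 2) \<noteq> tm (n - 1)"
    and 2: "tm l \<noteq> tm (l + 2) \<or> tm (l + 1) \<noteq> tm (l + 3) \<and> tm (n - 3) \<noteq> tm (n - 1)"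
      "tm (n - 4) \<noteq> tm (n - 2)"
    and 3: "\<nexists>c. \<forall>j < 3. (tm (n - 3 + j) \<noteq> tm (l + j)) = c"
    and 5: "tm l = tm (l + 5) \<Longrightarrow> tm (l + 1) = tm (l + 6) \<Longrightarrow>
      tm (l + 2) \<noteq> tm (l + 7) \<and> tm (n - 7) \<noteq> tm (n - 2)"
  shows "cubefree_morphism (clipped_TM l k)"
proof (rule cubefree_clipped_TM_oddI[OF assms(1,2)])
  fix a b :: nat
  assume ab: "a \<le> 3" "b \<le> 3" "a + b \<in> {1, 2, 3, 5}"
  show "\<not> boundary_cube l k a b"
  proof
    assume "boundary_cube l k a b"
    then have A: "\<And>j. j < a \<Longrightarrow> tm (n - (a + b) - a + j) = tm (n - a + j)"
      and C: "\<exists>c. \<forall>j < a + b. (tm (n - (a + b) + j) \<noteq> tm (l + j)) = c"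
      and B: "\<And>j. j < b \<Longrightarrow> tm (l + j) = tm (l + (a + b) + j)"
      unfolding boundary_cube_def n by blast+
    have "8 \<le> n" using assms(2) n by simp
    have "a + b \<noteq> 3" using C 3 by metis
    moreover have "\<not> (a = 1 \<and> b = 0)"
      by (rule notI) (use A[of 0] 1(2) in \<open>simp add: numeral_2_eq_2\<close>)
    moreover have "\<not> (a = 0 \<and> b = 1)"
      by (rule notI) (use B[of 0] 1(1) in simp)
    moreover have "\<not> (a = 2 \<and> b = 0)"
      by (rule notI) (use A[of 0] 2(2) in simp)
    moreover have "\<not> (a = 1 \<and> b = 1)"
      by (rule notI) (use A[of 0] B[of 0] 2(1) in \<open>simp add: numeral_eq_Suc\<close>)
    moreover have "\<not> (a = 0 \<and> b = 2)"
      by (rule notI) (use B[of 0] B[of 1] 2(1) in \<open>simp add: numeral_eq_Suc\<close>)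
    moreover have "\<not> (a = 2 \<and> b = 3)"
      by (rule notI) (use B[of 0] B[of 1] B[of 2] 5 in \<open>simp add: numeral_eq_Suc\<close>)
    moreover have "\<not> (a = 3 \<and> b = 2)"
    proof
      assume ab: "a = 3 \<and> b = 2"
      have *: "n - 8 + 1 = n - 7" "n - 3 + 1 = n - 2" using \<open>8 \<le> n\<close> by simp_all
      have "tm (n - 7) = tm (n - 2)" using A[of 1] ab unfolding *[symmetric] by simp
      then show False using B[of 0] B[of 1] 5 ab by (simp add: numeral_eq_Suc)
    qed
    moreover have "a = 0 \<and> b = 1 \<or> a = 1 \<and> b = 0 \<or> a = 0 \<and> b = 2 \<or> a = 1 \<and> b = 1 \<or> a = 2 \<and> b = 0 \<or>
      a + b = 3 \<or> a = 2 \<and> b = 3 \<or> a = 3 \<and> b = 2"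
    proof -
      have "a = 0 \<or> a = 1 \<or> a = 2 \<or> a = 3" "b = 0 \<or> b = 1 \<or> b = 2 \<or> b = 3" using ab(1,2) by linarith+
      then show ?thesis using ab(3) by (elim disjE) simp_all
    qed
    ultimately show False by blast
  qed
qed

lemma tm_octave:
  "tm (8 * q) = tm q" "tm (8 * q + 1) = (\<not> tm q)" "tm (8 * q + 2) = (\<not> tm q)" "tm (8 * q + 3) = tm q"
  "tm (8 * q + 4) = (\<not> tm q)" "tm (8 * q + 5) = tm q" "tm (8 * q + 6) = tm q" "tm (8 * q + 7) = (\<not> tm q)"
proof -
  have "8 * q = 2 * (2 * (2 * q))" "8 * q + 1 = Suc (2 * (2 * (2 * q)))" "8 * q + 2 = 2 * Suc (2 * (2 * q))"
    "8 * q + 3 = Suc (2 * Suc (2 * (2 * q)))" "8 * q + 4 = 2 * (2 * Suc (2 * q))" "8 * q + 5 = Suc (2 * (2 * Suc (2 * q)))"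
    "8 * q + 6 = 2 * Suc (2 * Suc (2 * q))" "8 * q + 7 = Suc (2 * Suc (2 * Suc (2 * q)))" by simp_all
  then show "tm (8 * q) = tm q" "tm (8 * q + 1) = (\<not> tm q)" "tm (8 * q + 2) = (\<not> tm q)" "tm (8 * q + 3) = tm q"
    "tm (8 * q + 4) = (\<not> tm q)" "tm (8 * q + 5) = tm q" "tm (8 * q + 6) = tm q" "tm (8 * q + 7) = (\<not> tm q)"
    by (simp_all only: tm_even tm_odd not_not)
qed

lemma tm_values:
  "\<not> tm 0" "tm 1" "tm 2" "\<not> tm 3" "tm 4" "\<not> tm 5" "\<not> tm 6" "tm 7"
  "tm 8" "\<not> tm 9" "\<not> tm 10" "tm 11" "\<not> tm 12" "tm 13"
  using tm_octave[of 0] tm_octave[of 1] tm_0 tm_odd[of 0] by (simp_all add: numeral_2_eq_2)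

text \<open>The blocks begin with \<open>0110\<close> or \<open>1001\<close>, whose first and third letter differ, and end in a word \<open>xxyx\<close>
  with \<open>x \<noteq> y\<close>. Their first three letters do not alternate whereas the last three do, which excludes
  period three; the first two letters are not repeated as the sixth and seventh, which excludes period five.\<close>
lemma cubefree_clipped_TM_1_5_7_mod_8:
  assumes "odd k" "9 \<le> k" "l \<in> {0, 4, 6}" "l + k = 8 * q + 5"
  shows "cubefree_morphism (clipped_TM l k)"
proof (rule cubefree_clipped_TM_boundaryI[OF assms(1,2,4)])
  have pre: "tm (l + 1) = (\<not> tm l)" "tm (l + 2) = (\<not> tm l)" "\<not> (tm l = tm (l + 5) \<and> tm (l + 1) = tm (l + 6))"
    using assms(3) tm_values by (auto simp: numeral_2_eq_2)
  have idx: "8 * q + 5 - 1 = 8 * q + 4" "8 * q + 5 - 2 = 8 * q + 3" "8 * q + 5 - 4 = 8 * q + 1" 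
    "8 * q + 5 - 3 = 8 * q + 2" by simp_all
  show "tm l \<noteq> tm (l + 1)" using pre by simp
  show "tm (8 * q + 5 - 2) \<noteq> tm (8 * q + 5 - 1)" unfolding idx tm_octave by simp
  show "tm l \<noteq> tm (l + 2) \<or> tm (l + 1) \<noteq> tm (l + 3) \<and> tm (8 * q + 5 - 3) \<noteq> tm (8 * q + 5 - 1)" using pre by simp
  show "tm (8 * q + 5 - 4) \<noteq> tm (8 * q + 5 - 2)" unfolding idx tm_octave by simp
  show "\<nexists>c. \<forall>j < 3. (tm (8 * q + 5 - 3 + j) \<noteq> tm (l + j)) = c"
  proof
    assume "\<exists>c. \<forall>j < 3. (tm (8 * q + 5 - 3 + j) \<noteq> tm (l + j)) = c"
    then obtain c where c: "\<And>j. j < 3 \<Longrightarrow> (tm (8 * q + 2 + j) \<noteq> tm (l + j)) = c" unfolding idx by blast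
    have *: "8 * q + 2 + 1 = 8 * q + 3" "8 * q + 2 + 2 = 8 * q + 4" by simp_all
    have "(tm (8 * q + 2 + 1) \<noteq> tm (l + 1)) = (tm (8 * q + 2 + 2) \<noteq> tm (l + 2))"
      using c[of 1] c[of 2] by simp
    then show False using pre(1,2) unfolding * tm_octave by auto
  qed
  show "tm (l + 2) \<noteq> tm (l + 7) \<and> tm (8 * q + 5 - 7) \<noteq> tm (8 * q + 5 - 2)"
    if "tm l = tm (l + 5)" "tm (l + 1) = tm (l + 6)" using that pre(3) by blast
qed

text \<open>With \<open>x = t[q]\<close> and \<open>y = t[q+1] \<noteq> x\<close> the block begins with \<open>xyyx\<close> and ends in \<open>yyxy\<close>.
  The last three letters alternate, the first three do not, which excludes period three; the sixth
  letter is \<open>y\<close>, which excludes period five.\<close>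
lemma cubefree_clipped_TM_3_mod_8_distinct:
  assumes "tm q \<noteq> tm (q + 1)"
  shows "cubefree_morphism (clipped_TM (8 * q + 6) (8 * q + 11))"
proof (rule cubefree_clipped_TM_boundaryI)
  let ?l = "8 * q + 6" and ?n = "8 * (2 * (q + 1)) + 1"
  show "odd (8 * q + 11)" "9 \<le> 8 * q + 11" "?l + (8 * q + 11) = ?n" by simp_all
  have idx: "?l + 1 = 8 * q + 7" "?l + 2 = 8 * (q + 1)" "?l + 3 = 8 * (q + 1) + 1"
    "?l + 5 = 8 * (q + 1) + 3" "?l + 6 = 8 * (q + 1) + 4"
    "?n - 1 = 8 * (2 * (q + 1))" "?n - 2 = 8 * Suc (2 * q) + 7" "?n - 3 = 8 * Suc (2 * q) + 6" "?n - 4 = 8 * Suc (2 * q) + 5"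
    by simp_all
  show "tm ?l \<noteq> tm (?l + 1)" "tm (?n - 2) \<noteq> tm (?n - 1)" "tm (?n - 4) \<noteq> tm (?n - 2)"
    "tm ?l \<noteq> tm (?l + 2) \<or> tm (?l + 1) \<noteq> tm (?l + 3) \<and> tm (?n - 3) \<noteq> tm (?n - 1)"
    unfolding idx tm_octave tm_even tm_odd using assms by simp_all
  show "\<nexists>c. \<forall>j < 3. (tm (?n - 3 + j) \<noteq> tm (?l + j)) = c"
  proof
    assume "\<exists>c. \<forall>j < 3. (tm (?n - 3 + j) \<noteq> tm (?l + j)) = c"
    then obtain c where c: "\<And>j. j < 3 \<Longrightarrow> (tm (?n - 3 + j) \<noteq> tm (?l + j)) = c" by blast
    have "?n - 3 + 1 = ?n - 2" "?n - 3 + 2 = ?n - 1" by simp_all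
    then have "(tm (?n - 2) \<noteq> tm (?l + 1)) = (tm (?n - 1) \<noteq> tm (?l + 2))" using c[of 1] c[of 2] by simp
    then show False unfolding idx tm_octave tm_even tm_odd using assms by simp
  qed
  show "tm (?l + 2) \<noteq> tm (?l + 7) \<and> tm (?n - 7) \<noteq> tm (?n - 2)"
    if "tm ?l = tm (?l + 5)" "tm (?l + 1) = tm (?l + 6)"
    using that(1) assms unfolding idx tm_octave by simp
qed

text \<open>With \<open>x = t[q] = t[q+1]\<close> and its complement \<open>y\<close> the block begins with \<open>yxyy\<close> and ends in \<open>yxxy\<close>.
  Here the first three letters alternate and the last three do not, which excludes period three.
  Period five would require that the third letter \<open>y\<close> is equal to the eighth letter \<open>x\<close>, or the
  seventh letter from the end, \<open>y\<close>, to the second from the end, \<open>x\<close>.\<close>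
lemma cubefree_clipped_TM_3_mod_8_equal:
  assumes "tm q = tm (q + 1)"
  shows "cubefree_morphism (clipped_TM (8 * q + 7) (8 * q + 11))"
proof (rule cubefree_clipped_TM_boundaryI)
  let ?l = "8 * q + 7" and ?n = "8 * (2 * (q + 1)) + 2"
  show "odd (8 * q + 11)" "9 \<le> 8 * q + 11" "?l + (8 * q + 11) = ?n" by simp_all
  have idx: "?l + 1 = 8 * (q + 1)" "?l + 2 = 8 * (q + 1) + 1" "?l + 3 = 8 * (q + 1) + 2"
    "?l + 5 = 8 * (q + 1) + 4" "?l + 6 = 8 * (q + 1) + 5" "?l + 7 = 8 * (q + 1) + 6"
    "?n - 1 = 8 * (2 * (q + 1)) + 1" "?n - 2 = 8 * (2 * (q + 1))" "?n - 3 = 8 * Suc (2 * q) + 7"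
    "?n - 4 = 8 * Suc (2 * q) + 6" "?n - 7 = 8 * Suc (2 * q) + 3"
    by simp_all
  show "tm ?l \<noteq> tm (?l + 1)" "tm (?n - 2) \<noteq> tm (?n - 1)" "tm (?n - 4) \<noteq> tm (?n - 2)"
    "tm ?l \<noteq> tm (?l + 2) \<or> tm (?l + 1) \<noteq> tm (?l + 3) \<and> tm (?n - 3) \<noteq> tm (?n - 1)"
    unfolding idx tm_octave tm_even tm_odd using assms by simp_all
  show "\<nexists>c. \<forall>j < 3. (tm (?n - 3 + j) \<noteq> tm (?l + j)) = c"
  proof
    assume "\<exists>c. \<forall>j < 3. (tm (?n - 3 + j) \<noteq> tm (?l + j)) = c"
    then obtain c where c: "\<And>j. j < 3 \<Longrightarrow> (tm (?n - 3 + j) \<noteq> tm (?l + j)) = c" by blast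
    have "?n - 3 + 1 = ?n - 2" "?n - 3 + 2 = ?n - 1" by simp_all
    then have "(tm (?n - 3) \<noteq> tm ?l) = (tm (?n - 2) \<noteq> tm (?l + 1))" using c[of 0] c[of 1] by simp
    then show False unfolding idx tm_octave tm_even tm_odd using assms by simp
  qed
  show "tm (?l + 2) \<noteq> tm (?l + 7) \<and> tm (?n - 7) \<noteq> tm (?n - 2)"
    unfolding idx tm_octave tm_even tm_odd using assms by simp
qed

section \<open>Short blocks\<close>

text \<open>An executable form of the hypotheses of \<open>cubefree_morphism_synchronizingI\<close>: a cube of period below
  \<open>k\<close> that starts in the first block ends within the first four blocks, so four letters of the preimage
  suffice.\<close>
definition checked_block :: "bool list \<Rightarrow> bool" where
  "checked_block w \<longleftrightarrow> (let k = length w in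
     (\<forall>r \<in> set [1..<k]. \<forall>c \<in> set [False, True]. \<forall>d \<in> set [False, True].
       drop r w \<noteq> map (\<lambda>x. x \<noteq> c) (take (k - r) w) \<or> drop (k - r) w \<noteq> map (\<lambda>x. x \<noteq> d) (take r w)) \<and>
     (\<forall>a \<in> set [False, True]. \<forall>b \<in> set [False, True]. \<forall>c \<in> set [False, True]. \<forall>d \<in> set [False, True].
       (let y = concat (map (\<lambda>a. map (\<lambda>x. x \<noteq> a) w) [a, b, c, d]) in
       \<forall>p \<in> set [1..<k]. \<forall>r \<in> set [0..<k]. take (2 * p) (drop r y) \<noteq> take (2 * p) (drop (r + p) y))))"

lemma cubefree_morphism_checked_block:
  assumes ok: "checked_block w" and w: "w \<noteq> []" and h: "\<And>a. h a = map (\<lambda>x. x \<noteq> a) w"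
  shows "cubefree_morphism h"
proof (rule cubefree_morphism_synchronizingI)
  let ?k = "length w" and ?u = "\<lambda>j. w ! j"
  show "h a = map (\<lambda>j. ?u j \<noteq> a) [0..<?k]" for a
    unfolding h by (rule nth_equalityI) simp_all
  show "0 < ?k" using w by simp
  have bool: "x \<in> set [False, True]" for x by simp
  show "synchronizing ?u ?k"
    unfolding synchronizing_def
  proof (intro allI impI notI, elim conjE)
    fix r c d
    assume r: "0 < r" "r < ?k" and c: "\<forall>j < ?k - r. (?u j \<noteq> ?u (j + r)) = c"
      and d: "\<forall>j < r. (?u (?k - r + j) \<noteq> ?u j) = d"
    have "drop r w = map (\<lambda>x. x \<noteq> c) (take (?k - r) w)"
    proof (rule nth_equalityI)
      fix j assume "j < length (drop r w)"
      then show "drop r w ! j = map (\<lambda>x. x \<noteq> c) (take (?k - r) w) ! j"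
        using c[rule_format, of j] by (simp add: add.commute) blast
    qed simp
    moreover have "drop (?k - r) w = map (\<lambda>x. x \<noteq> d) (take r w)"
    proof (rule nth_equalityI)
      fix j assume "j < length (drop (?k - r) w)"
      then show "drop (?k - r) w ! j = map (\<lambda>x. x \<noteq> d) (take r w) ! j"
        using d[rule_format, of j] r by simp blast
    qed (use r in simp)
    moreover have "r \<in> set [1..<?k]" using r by simp
    ultimately show False using ok bool unfolding checked_block_def Let_def by blast
  qed
  fix v r p assume p: "0 < p" "p < ?k" and r: "r < ?k"
  show "\<not> repetition (blocks ?u ?k v) r (3 * p) p"
  proof
    assume rep: "repetition (blocks ?u ?k v) r (3 * p) p"
    define y where "y = concat (map (\<lambda>a. map (\<lambda>x. x \<noteq> a) w) [v 0, v 1, v 2, v 3])"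
    have y: "y = map (blocks ?u ?k v) [0..<4 * ?k]"
    proof (rule nth_equalityI)
      show "length y = length (map (blocks ?u ?k v) [0..<4 * ?k])" by (simp add: y_def)
      fix i assume "i < length y"
      then have i: "i < 4 * ?k" by (simp add: y_def)
      then have "i div ?k < 4" by (simp add: less_mult_imp_div_less)
      then have "[v 0, v 1, v 2, v 3] ! (i div ?k) = v (i div ?k)"
        by (auto simp: less_Suc_eq numeral_eq_Suc)
      moreover have "y ! i = map (\<lambda>x. x \<noteq> [v 0, v 1, v 2, v 3] ! (i div ?k)) w ! (i mod ?k)"
        unfolding y_def by (rule concat_map_nth_uniform) (use i in simp_all)
      moreover have "i mod ?k < ?k" using w by simp
      ultimately show "y ! i = map (blocks ?u ?k v) [0..<4 * ?k] ! i"
        using i by (simp add: blocks_def)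
    qed
    have "take (2 * p) (drop r y) = take (2 * p) (drop (r + p) y)"
      unfolding y
    proof (rule nth_equalityI)
      fix j assume "j < length (take (2 * p) (drop r (map (blocks ?u ?k v) [0..<4 * ?k])))"
      then show "take (2 * p) (drop r (map (blocks ?u ?k v) [0..<4 * ?k])) ! j =
          take (2 * p) (drop (r + p) (map (blocks ?u ?k v) [0..<4 * ?k])) ! j"
        using rep p r unfolding repetition_def by (simp add: add_ac)
    qed (use p r in simp)
    moreover have "p \<in> set [1..<?k]" "r \<in> set [0..<?k]" using p r by simp_all
    ultimately show False using ok bool unfolding checked_block_def Let_def y_def by blast
  qed
qed

lemma clipped_TM_short:
  "clipped_TM 0 5 a = map (\<lambda>x. x \<noteq> a) [False, True, True, False, True]"
  "clipped_TM 6 7 a = map (\<lambda>x. x \<noteq> a) [False, True, True, False, False, True, False]"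
  using tm_values by (simp_all add: clipped_TM_eq upt_conv_Cons numeral_eq_Suc)

lemma cubefree_clipped_TM_1: "cubefree_morphism (clipped_TM l 1)"
  by (rule cubefree_morphism_complementI[OF clipped_TM_eq, of _ 0]) simp_all

lemma cubefree_clipped_TM_5_7:
  "cubefree_morphism (clipped_TM 0 5)" "cubefree_morphism (clipped_TM 6 7)"
proof -
  have "checked_block [False, True, True, False, True]"
    "checked_block [False, True, True, False, False, True, False]" by code_simp+
  then show "cubefree_morphism (clipped_TM 0 5)" "cubefree_morphism (clipped_TM 6 7)"
    by (auto intro: cubefree_morphism_checked_block[OF _ _ clipped_TM_short(1)]
      cubefree_morphism_checked_block[OF _ _ clipped_TM_short(2)])
qed

section \<open>Existence of cubefree clipped Thue--Morse morphisms\<close>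

theorem theorem15:
  fixes k m n :: nat
  assumes "m \<ge> 1" and "odd m" and "k = m * 2 ^ n"
  shows "((\<exists>l. cubefree_morphism (clipped_TM l k)) \<longleftrightarrow> m \<noteq> 3) \<and>
    (m \<noteq> 3 \<longrightarrow>
      (m mod 8 = 1 \<longrightarrow> cubefree_morphism (clipped_TM (4 * 2 ^ n) k)) \<and>
      (m mod 8 = 3 \<longrightarrow> cubefree_morphism (clipped_TM (k - 5 * 2 ^ n) k) \<or>
                       cubefree_morphism (clipped_TM (k - 4 * 2 ^ n) k)) \<and>
      (m mod 8 = 5 \<longrightarrow> cubefree_morphism (clipped_TM 0 k)) \<and>
      (m mod 8 = 7 \<longrightarrow> cubefree_morphism (clipped_TM (6 * 2 ^ n) k)))"
proof (cases "m = 3")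
  case True
  then show ?thesis using not_cubefree_morphism_three_power assms(3) by simp
next
  case False
  have power: "cubefree_morphism (clipped_TM (l * 2 ^ n) k)" if "cubefree_morphism (clipped_TM l m)" for l
    using cubefree_clipped_TM_power[OF that, of n] assms by simp
  have case157: "cubefree_morphism (clipped_TM (l * 2 ^ n) k)"
    if l: "l \<in> {0, 4, 6}" and mod: "(l + m) mod 8 = 5" and m: "9 \<le> m" for l
  proof -
    have "l + m = 8 * ((l + m) div 8) + 5" using mult_div_mod_eq[of 8 "l + m"] mod by simp
    from cubefree_clipped_TM_1_5_7_mod_8[OF assms(2) m l this] show ?thesis by (rule power)
  qed
  have m1: "cubefree_morphism (clipped_TM (4 * 2 ^ n) k)" if "m mod 8 = 1"
  proof (cases "m = 1")
    case True
    then show ?thesis using power[of 4] cubefree_clipped_TM_1 by simp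
  next
    case False
    then have "(4 + m) mod 8 = 5" "9 \<le> m" using that by presburger+
    then show ?thesis using case157[of 4] by simp
  qed
  have m5: "cubefree_morphism (clipped_TM 0 k)" if "m mod 8 = 5"
  proof (cases "m = 5")
    case True
    then show ?thesis using power[of 0] cubefree_clipped_TM_5_7 by simp
  next
    case False
    then have "(0 + m) mod 8 = 5" "9 \<le> m" using that by presburger+
    then show ?thesis using case157[of 0] by simp
  qed
  have m7: "cubefree_morphism (clipped_TM (6 * 2 ^ n) k)" if "m mod 8 = 7"
  proof (cases "m = 7")
    case True
    then show ?thesis using power[of 6] cubefree_clipped_TM_5_7 by simp
  next
    case False
    then have "(6 + m) mod 8 = 5" "9 \<le> m" using that by presburger+
    then show ?thesis using case157[of 6] by simp
  qed
  have m3: "cubefree_morphism (clipped_TM (k - 5 * 2 ^ n) k) \<or>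
      cubefree_morphism (clipped_TM (k - 4 * 2 ^ n) k)" if "m mod 8 = 3"
  proof -
    have "m = 8 * (m div 8) + 3" using mult_div_mod_eq[of 8 m] that by simp
    moreover define q where "q = m div 8 - 1"
    ultimately have m: "m = 8 * q + 11" using False by (cases "m div 8") simp_all
    have "k - 5 * 2 ^ n = (8 * q + 6) * 2 ^ n" "k - 4 * 2 ^ n = (8 * q + 7) * 2 ^ n"
      using assms(3) m by (simp_all flip: diff_mult_distrib)
    then show ?thesis
      using power[of "8 * q + 6"] power[of "8 * q + 7"] m
        cubefree_clipped_TM_3_mod_8_distinct[of q] cubefree_clipped_TM_3_mod_8_equal[of q] by auto
  qed
  have "m mod 8 = 1 \<or> m mod 8 = 3 \<or> m mod 8 = 5 \<or> m mod 8 = 7" using assms(2) by presburger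
  then have "\<exists>l. cubefree_morphism (clipped_TM l k)" using m1 m3 m5 m7 by blast
  then show ?thesis using False m1 m3 m5 m7 by blast
qed

end
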